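(* For all $n \geq 1$, there exists $\epsilon_n > 0$ such that for every $c \in \mathbb{R}_{>0}^n$ with $\sum_{i=1}^n c_i = n$ and $\|c - \mathbf{1}\|_1 < \epsilon_n$, the matrix $\frac{1}{n} \mathbf{1} c^\top$ is the unique minimizer of the permanent over $\mathrm{Mat}_n(c)$. Specifically, for $n\ge 2$ and $c \in \mathbb{R}_{>0}^n$ with $\sum_{i=1}^n c_i = n$, the matrix $\frac1n \mathbf 1 c^\top$ is the unique minimizer of the permanent over $\mathrm{Mat}_n(c)$ whenever $$\frac{c_1 c_2 \cdots c_n}{L(c)} < \frac{(n-2)^{n-2} n^{n-1}}{(n-1)^{2n-3}},$$ where $L(c)>0$ is any lower bound on the capacity, i.e. any positive real number such that $\mathrm{Cap}_{\mathbf{1}}(p_M) \ge L(c)$ for all $M \in \mathrm{Mat}_n(c)$.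
   Context: For $c \in \mathbb{R}_{\ge 0}^n$, $\mathrm{Mat}_n(c)$ is the set of $n\times n$ real matrices with non-negative entries, all row sums equal to $1$, and column sums $c_1,\dots,c_n$. For $M=(m_{ij}) \in \mathrm{Mat}_n(c)$, $p_M(x) := \prod_{i=1}^n \sum_{j=1}^n m_{ij}x_j$, and $\mathrm{Cap}_{\mathbf 1}(p_M) := \inf_{x_1,\dots,x_n>0} \frac{p_M(x)}{x_1\cdots x_n}$. $\mathbf 1$ is the all-ones (column) vector, $\|\cdot\|_1$ the $\ell^1$ norm, and $0^0=1$. *)

theory Defs
  imports Complex_Main "HOL-Combinatorics.Permutations" "Jordan_Normal_Form.Matrix"
begin

text \<open>Rows, columns and coordinates are indexed by \<open>{0..<n}\<close>, following the matrix library.\<close>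

definition ones_vec :: "nat \<Rightarrow> real vec" where
  "ones_vec n = vec n (\<lambda>_. 1)"

definition l1_norm :: "real vec \<Rightarrow> real" where
  "l1_norm v = (\<Sum>i = 0..<dim_vec v. \<bar>v $ i\<bar>)"

text \<open>The outer product \<open>u v\<^sup>T\<close>.\<close>

definition outer_prod :: "real vec \<Rightarrow> real vec \<Rightarrow> real mat" where
  "outer_prod u v = mat (dim_vec u) (dim_vec v) (\<lambda>(i, j). u $ i * v $ j)"

definition pos_vecs :: "nat \<Rightarrow> real vec set" where
  "pos_vecs n = {x \<in> carrier_vec n. \<forall>i<n. 0 < x $ i}"

definition Mat_set :: "nat \<Rightarrow> real vec \<Rightarrow> real mat set" where
  "Mat_set n c = {M \<in> carrier_mat n n.
     (\<forall>i<n. \<forall>j<n. 0 \<le> M $$ (i, j)) \<and>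
     (\<forall>i<n. (\<Sum>j = 0..<n. M $$ (i, j)) = 1) \<and>
     (\<forall>j<n. (\<Sum>i = 0..<n. M $$ (i, j)) = c $ j)}"

text \<open>Only meaningful for square matrices.\<close>

definition permanent :: "real mat \<Rightarrow> real" where
  "permanent M = (\<Sum>p \<in> {p. p permutes {0..<dim_row M}}. \<Prod>i = 0..<dim_row M. M $$ (i, p i))"

definition prod_poly :: "real mat \<Rightarrow> real vec \<Rightarrow> real" where
  "prod_poly M x = (\<Prod>i = 0..<dim_row M. \<Sum>j = 0..<dim_col M. M $$ (i, j) * x $ j)"

text \<open>The capacity at the all-ones exponent of a polynomial function in \<open>n\<close> variables.  The real
  infimum is the intended one when \<open>p\<close> is non-negative on the positive orthant, as is
  \<open>prod_poly M\<close> for entrywise non-negative \<open>M\<close>.\<close>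

definition Cap_one :: "nat \<Rightarrow> (real vec \<Rightarrow> real) \<Rightarrow> real" where
  "Cap_one n p = (INF x \<in> pos_vecs n. p x / (\<Prod>i = 0..<n. x $ i))"

definition unique_minimizer :: "('a \<Rightarrow> real) \<Rightarrow> 'a set \<Rightarrow> 'a \<Rightarrow> bool" where
  "unique_minimizer f S a \<longleftrightarrow> (\<forall>x. is_arg_min f (\<lambda>y. y \<in> S) x \<longleftrightarrow> x = a)"

end

theory Submission
  imports Defs "Jordan_Normal_Form.Determinant" "HOL-Analysis.Convex"
    "HOL-Combinatorics.Multiset_Permutations"
begin

text \<open>
  By Gurvits' argument, eliminating the variables of \<open>p\<^sub>M\<close> one at a time bounds the permanent below by the
  capacity times \<open>\<Prod>\<^sub>k g(k)\<close> with \<open>g(k) = (1 - 1 / k)^(k - 1)\<close>, where \<open>k\<close> bounds the degree in the variable being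
  eliminated.  The elimination step only needs a log-concavity that is Alexandrov's inequality for
  permanents; that inequality is proved by induction on the size with the Bochner method of Shenfeld and
  van Handel, which requires no deformation argument.  If \<open>M\<close> has a zero entry, its column is eliminated
  first, with degree \<open>n - 1\<close>, and the gain \<open>g(n - 1) / g(n)\<close> is the constant of the theorem.  Hence under
  the hypothesis every matrix with a zero entry has a larger permanent than \<open>(1 / n) \<one> c\<^sup>T\<close>, so a minimizer
  is positive.  Along the line through a positive minimizer that mixes two distinct rows, the permanent
  could not increase before an entry vanishes; so all rows agree.  Near \<open>c = \<one>\<close>, compactness makes every
  \<open>M\<close> dominate \<open>(1 - \<delta>) D\<close> for some doubly stochastic \<open>D\<close>, whose capacity is at least \<open>1\<close>.
\<close>

section \<open>Alexandrov's inequality for permanents\<close>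

text \<open>The permanent with row set \<open>S\<close> and columns \<open>vs\<close>, by Laplace
  expansion along the first column. A list of columns allows repetitions, as in a symmetric
  multilinear form. It is a permanent only if \<open>card S = length vs\<close>; a shorter list
  gives a sum over injections of columns into rows.\<close>

primrec lperm :: "('i \<Rightarrow> real) list \<Rightarrow> 'i set \<Rightarrow> real" where
  "lperm [] S = 1"
| "lperm (v # vs) S = (\<Sum>i\<in>S. v i * lperm vs (S - {i}))"

text \<open>Two expansions give a sum over ordered pairs of distinct rows; extended by zero to all
  pairs, its two summations commute.\<close>

lemma lperm_swap:
  assumes "finite S"
  shows "lperm (u # v # vs) S = lperm (v # u # vs) S"
proof -
  have *: "lperm (a # b # vs) S = (\<Sum>i\<in>S. \<Sum>j\<in>S. if i \<noteq> j then a i * b j * lperm vs (S - {i,j}) else 0)" for a b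
  proof -
    have "lperm (a # b # vs) S = (\<Sum>i\<in>S. \<Sum>j\<in>S-{i}. a i * b j * lperm vs (S - {i,j}))"
      by (auto simp: sum_distrib_left Diff_insert2[symmetric] mult.assoc intro!: sum.cong
          arg_cong2[where f = times] arg_cong2[where f = lperm])
    also have "\<dots> = (\<Sum>i\<in>S. \<Sum>j\<in>S. if i \<noteq> j then a i * b j * lperm vs (S - {i,j}) else 0)"
      by (intro sum.cong refl sum.mono_neutral_cong_left) (use assms in auto)
    finally show ?thesis .
  qed
  show ?thesis
    unfolding * by (subst sum.swap, intro sum.cong refl) (simp add: insert_commute eq_commute mult.commute)
qed

lemma lperm_move:
  assumes "finite S"
  shows "lperm (v # xs @ ys) S = lperm (xs @ v # ys) S"
  using assms
proof (induction xs arbitrary: S)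
  case (Cons x xs)
  have "lperm (v # (x # xs) @ ys) S = lperm (x # v # (xs @ ys)) S"
    using lperm_swap[OF Cons.prems, of v x "xs @ ys"] by simp
  also have "\<dots> = lperm ([x] @ (xs @ v # ys)) S"
    using Cons by (auto intro!: sum.cong simp del: lperm.simps(2) simp add: lperm.simps(2)[of x])
  finally show ?case by simp
qed simp

text \<open>Any column can be moved to the front, so only the multiset of columns matters.\<close>

lemma lperm_mset_cong:
  assumes "mset xs = mset ys" "finite S"
  shows "lperm xs S = lperm ys S"
  using assms
proof (induction xs arbitrary: ys S)
  case (Cons x xs)
  then obtain as bs where ys: "ys = as @ x # bs"
    using split_list[of x ys] mset_eq_setD[OF Cons.prems(1)] by (metis list.set_intros(1))
  have "lperm xs (S - {i}) = lperm (as @ bs) (S - {i})" for i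
    using Cons.prems by (intro Cons.IH) (auto simp: ys)
  then show ?case
    using lperm_move[OF Cons.prems(2), of x as bs] by (simp add: ys)
qed simp

lemma lperm_pos:
  assumes "\<And>v i. v \<in> set vs \<Longrightarrow> i \<in> S \<Longrightarrow> 0 < v i" "card S = length vs" "finite S"
  shows "0 < lperm vs S"
  using assms
proof (induction vs arbitrary: S)
  case (Cons v vs)
  then have "S \<noteq> {}" by auto
  then show ?case
    using Cons.prems by (auto intro!: sum_pos mult_pos_pos Cons.IH)
qed simp

lemma lperm_add: "lperm ((\<lambda>i. u i + t * v i) # vs) S = lperm (u # vs) S + t * lperm (v # vs) S"
  by (simp add: sum.distrib sum_distrib_left algebra_simps)

text \<open>All assignments of rows to equal columns contribute the same product. Thus a product of
  linear forms is itself a permanent, with equal columns, up to a factorial.\<close>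

lemma lperm_replicate:
  assumes "finite S" "card S = k"
  shows "lperm (replicate k y) S = fact k * (\<Prod>i\<in>S. y i)"
  using assms
proof (induction k arbitrary: S)
  case (Suc k)
  have "lperm (replicate (Suc k) y) S = (\<Sum>i\<in>S. fact k * (\<Prod>j\<in>S. y j))"
    unfolding replicate_Suc lperm.simps
  proof (rule sum.cong[OF refl])
    fix i assume "i \<in> S"
    then show "y i * lperm (replicate k y) (S - {i}) = fact k * (\<Prod>j\<in>S. y j)"
      using Suc prod.remove[of S i y] by simp
  qed
  then show ?case using Suc.prems by simp
qed simp

text \<open>For a square system injectivity gives solvability. An enumeration of \<open>S\<close>
  turns \<open>K\<close> into a matrix whose non-zero determinant provides an inverse.\<close>

lemma linear_system_solvable:
  fixes K :: "'i \<Rightarrow> 'i \<Rightarrow> real"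
  assumes fin: "finite S"
    and inj: "\<And>x. (\<And>i. i \<in> S \<Longrightarrow> (\<Sum>j\<in>S. K i j * x j) = 0) \<Longrightarrow> (\<And>i. i \<in> S \<Longrightarrow> x i = 0)"
  shows "\<exists>x. \<forall>i\<in>S. (\<Sum>j\<in>S. K i j * x j) = y i"
proof -
  define n where "n = card S"
  obtain h where h: "bij_betw h {0..<n} S"
    using ex_bij_betw_nat_finite[OF fin] n_def by blast
  define h' where "h' = inv_into {0..<n} h"
  have h'h: "h' (h i) = i" if "i < n" for i
    using h that by (simp add: h'_def bij_betw_def inv_into_f_f)
  have hh': "h (h' s) = s" "h' s < n" if "s \<in> S" for s
    using h that by (auto simp: h'_def bij_betw_def f_inv_into_f dest: inv_into_into[of s h "{0..<n}"])
  define A where "A = mat n n (\<lambda>(i,j). K (h i) (h j))"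
  have A: "A \<in> carrier_mat n n" by (simp add: A_def)
  have row: "(A *\<^sub>v v) $ h' s = (\<Sum>j\<in>S. K s j * v $ h' j)" if "s \<in> S" "v \<in> carrier_vec n" for s v
  proof -
    have "(A *\<^sub>v v) $ h' s = (\<Sum>j = 0..<n. K s (h j) * v $ j)"
      using that hh'[OF that(1)] by (simp add: A_def scalar_prod_def)
    also have "\<dots> = (\<Sum>j\<in>S. K s j * v $ h' j)"
      unfolding sum.reindex_bij_betw[OF h, of "\<lambda>j. K s j * v $ h' j", symmetric]
      by (intro sum.cong refl) (simp add: h'h)
    finally show ?thesis .
  qed
  have "det A \<noteq> 0"
  proof
    assume "det A = 0"
    then obtain v where v: "v \<in> carrier_vec n" "v \<noteq> 0\<^sub>v n" "A *\<^sub>v v = 0\<^sub>v n"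
      using det_0_iff_vec_prod_zero_field[OF A] by blast
    have "v $ h' s = 0" if "s \<in> S" for s
      by (rule inj[of "\<lambda>s. v $ h' s", OF _ that]) (use row[OF _ v(1)] v(3) hh' in simp)
    then have v0: "v $ h' s = 0" if "s \<in> S" for s
      using that by blast
    have "v $ i = 0" if "i < n" for i
      using v0[of "h i"] bij_betwE[OF h] h'h[OF that] that by simp
    then show False using v by (auto intro: eq_vecI)
  qed
  then obtain B where B: "B \<in> carrier_mat n n" "A * B = 1\<^sub>m n"
    using det_non_zero_imp_unit[OF A, where b = "()"] by (auto simp: Units_def ring_mat_def)
  define b where "b = vec n (\<lambda>i. y (h i))"
  have b: "b \<in> carrier_vec n" by (simp add: b_def)
  have "A *\<^sub>v (B *\<^sub>v b) = b"
    using assoc_mult_mat_vec[OF A B(1) b] B(2) b by simp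
  then have "(\<Sum>j\<in>S. K s j * (B *\<^sub>v b) $ h' j) = y s" if "s \<in> S" for s
    using row[OF that, of "B *\<^sub>v b"] B b hh'[OF that] by (simp add: b_def)
  then show ?thesis by (intro exI[of _ "\<lambda>j. (B *\<^sub>v b) $ h' j"]) blast
qed

section \<open>Hyperbolicity of the permanent as a form in two free columns\<close>

lemma lperm_diff: "lperm ((\<lambda>i. u i - t * v i) # vs) S = lperm (u # vs) S - t * lperm (v # vs) S"
  using lperm_add[of u "-t" v vs S] by simp

lemma lperm_combine_square:
  assumes "finite S"
  shows "lperm ((\<lambda>i. u i - t * v i) # (\<lambda>i. u i - t * v i) # A) S
    = lperm (u # u # A) S - 2 * t * lperm (u # v # A) S + t\<^sup>2 * lperm (v # v # A) S"
proof -
  have "lperm ((\<lambda>i. u i - t * v i) # (\<lambda>i. u i - t * v i) # A) S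
    = lperm (u # (\<lambda>i. u i - t * v i) # A) S - t * lperm (v # (\<lambda>i. u i - t * v i) # A) S"
    by (rule lperm_diff)
  also have "\<dots> = lperm ((\<lambda>i. u i - t * v i) # u # A) S - t * lperm ((\<lambda>i. u i - t * v i) # v # A) S"
    by (simp only: lperm_swap[OF assms, of _ "\<lambda>i. u i - t * v i"])
  also have "\<dots> = lperm (u # u # A) S - t * lperm (v # u # A) S - t * (lperm (u # v # A) S - t * lperm (v # v # A) S)"
    by (simp only: lperm_diff)
  also have "lperm (v # u # A) S = lperm (u # v # A) S"
    by (rule lperm_swap[OF assms])
  finally show ?thesis by (simp add: algebra_simps power2_eq_square)
qed

text \<open>The induction step of Alexandrov's inequality: \<open>IH\<close> is the inequality with
  one row and one column fewer. \<open>B\<close> is the form in two free columns, \<open>q\<close>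
  its matrix off the diagonal, and \<open>G\<close> its application to a vector. The weights
  \<open>w\<close> are chosen so that \<open>G / w\<close> fixes the vector \<open>a\<close>, which
  is also one of the fixed columns.\<close>

context
  fixes S :: "'i set" and a :: "'i \<Rightarrow> real" and A' :: "('i \<Rightarrow> real) list"
  assumes fin: "finite S" and card: "card S = length A' + 3"
    and a_pos: "\<And>i. 0 < a i" and A'_pos: "\<And>v i. v \<in> set A' \<Longrightarrow> 0 < v i"
    and IH: "\<And>i x. i \<in> S \<Longrightarrow> (lperm (x # a # A') (S - {i}))\<^sup>2
               \<ge> lperm (x # x # A') (S - {i}) * lperm (a # a # A') (S - {i})"
begin

private abbreviation (input) "G i x \<equiv> lperm (x # a # A') (S - {i})"
private abbreviation (input) "B u v \<equiv> lperm (u # v # a # A') S"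
private abbreviation (input) "p i \<equiv> G i a"
private abbreviation (input) "w i \<equiv> G i a / a i"
private abbreviation (input) "q i j \<equiv> lperm (a # A') (S - {i} - {j})"

private lemma p_pos: "i \<in> S \<Longrightarrow> 0 < p i"
  using fin card A'_pos a_pos by (intro lperm_pos) auto

private lemma w_pos: "i \<in> S \<Longrightarrow> 0 < w i"
  using p_pos a_pos by simp

private lemma q_pos: "i \<in> S \<Longrightarrow> j \<in> S \<Longrightarrow> i \<noteq> j \<Longrightarrow> 0 < q i j"
  using fin card A'_pos a_pos by (intro lperm_pos) auto

private lemma B_eq: "B x y = (\<Sum>i\<in>S. x i * G i y)"
  by simp

private lemma B_sym: "B x y = B y x"
  by (rule lperm_swap[OF fin])

private lemma G_eq: "G i x = (\<Sum>j\<in>S - {i}. x j * q i j)"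
  by simp

text \<open>Summing the induction hypothesis over the rows gives \<open>T\<^sup>2 \<ge> T\<close> for the self-adjoint operator
  \<open>T x = G x / w\<close> of the form \<open>B\<close> in the \<open>w\<close>-weighted inner product.\<close>

private lemma operator_square: "B x x \<le> (\<Sum>i\<in>S. (G i x)\<^sup>2 / w i)"
proof -
  \<comment> \<open>Expanding along the fixed column \<open>a\<close> exposes the minors that
    \<open>IH\<close> compares with the squares of \<open>G i x\<close>.\<close>
  have "B x x = lperm (a # x # x # A') S"
    by (rule lperm_mset_cong[OF _ fin]) simp
  also have "\<dots> = (\<Sum>i\<in>S. a i * lperm (x # x # A') (S - {i}))"
    by (rule lperm.simps(2))
  also have "\<dots> \<le> (\<Sum>i\<in>S. a i * ((G i x)\<^sup>2 / p i))"
    using IH p_pos a_pos by (intro sum_mono mult_left_mono) (simp_all only: pos_le_divide_eq less_imp_le)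
  finally show ?thesis by (simp add: field_simps del: lperm.simps)
qed

text \<open>Since \<open>T a = a\<close> with positive entries, \<open>T \<le> 1\<close> by the Perron argument.\<close>

private lemma perron_identity:
  "2 * ((\<Sum>i\<in>S. w i * (x i)\<^sup>2) - B x x)
     = (\<Sum>i\<in>S. \<Sum>j\<in>S-{i}. q i j * a i * a j * (x i / a i - x j / a j)\<^sup>2)"
proof -
  have a0: "a i \<noteq> 0" for i using a_pos[of i] by simp
  have sw: "(\<Sum>i\<in>S. \<Sum>j\<in>S-{i}. f i j) = (\<Sum>i\<in>S. \<Sum>j\<in>S-{i}. f j i)" for f :: "'i \<Rightarrow> 'i \<Rightarrow> real"
  proof -
    have *: "(\<Sum>i\<in>S. \<Sum>j\<in>S-{i}. g i j) = (\<Sum>i\<in>S. \<Sum>j\<in>S. if i \<noteq> j then g i j else 0)" for g :: "'i \<Rightarrow> 'i \<Rightarrow> real"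
      by (intro sum.cong refl sum.mono_neutral_cong_left) (use fin in auto)
    show ?thesis unfolding * by (subst sum.swap, intro sum.cong refl) auto
  qed
  have qs: "q i j = q j i" for i j
    by (simp add: Diff_insert2[symmetric] insert_commute del: lperm.simps)
  have w: "(\<Sum>i\<in>S. w i * (x i)\<^sup>2) = (\<Sum>i\<in>S. \<Sum>j\<in>S-{i}. q i j * a j / a i * (x i)\<^sup>2)"
    unfolding G_eq by (simp add: sum_divide_distrib sum_distrib_right sum_distrib_left mult_ac del: lperm.simps)
  have w': "(\<Sum>i\<in>S. w i * (x i)\<^sup>2) = (\<Sum>i\<in>S. \<Sum>j\<in>S-{i}. q i j * a i / a j * (x j)\<^sup>2)"
    unfolding w by (subst sw) (simp only: qs)
  have b: "B x x = (\<Sum>i\<in>S. \<Sum>j\<in>S-{i}. q i j * x i * x j)"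
    unfolding B_eq G_eq by (simp add: sum_distrib_left mult_ac del: lperm.simps)
  have "2 * ((\<Sum>i\<in>S. w i * (x i)\<^sup>2) - B x x)
     = (\<Sum>i\<in>S. w i * (x i)\<^sup>2) + (\<Sum>i\<in>S. w i * (x i)\<^sup>2) - 2 * B x x"
    by simp
  also have "\<dots> = (\<Sum>i\<in>S. \<Sum>j\<in>S-{i}. q i j * a j / a i * (x i)\<^sup>2 + q i j * a i / a j * (x j)\<^sup>2 - 2 * (q i j * x i * x j))"
    by (subst (1) w, subst w', subst b) (simp only: sum.distrib sum_subtractf sum_distrib_left)
  also have "\<dots> = (\<Sum>i\<in>S. \<Sum>j\<in>S-{i}. q i j * a i * a j * (x i / a i - x j / a j)\<^sup>2)"
    by (intro sum.cong refl) (simp add: field_simps power2_eq_square a0 del: lperm.simps)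
  finally show ?thesis .
qed

private lemma perron_nonneg: "B x x \<le> (\<Sum>i\<in>S. w i * (x i)\<^sup>2)"
proof -
  have "0 \<le> (\<Sum>i\<in>S. \<Sum>j\<in>S-{i}. q i j * a i * a j * (x i / a i - x j / a j)\<^sup>2)"
    using q_pos a_pos by (intro sum_nonneg mult_nonneg_nonneg) (auto intro: less_imp_le simp del: lperm.simps)
  then show ?thesis using perron_identity[of x] by simp
qed

text \<open>The weights \<open>q i j * a i * a j\<close> in \<open>perron_identity\<close> are
  positive for all pairs of distinct indices, so equality makes \<open>x\<close> a multiple of
  \<open>a\<close>: the eigenvalue 1 of \<open>T\<close> is simple.\<close>

private lemma perron_equality:
  assumes "B x x = (\<Sum>i\<in>S. w i * (x i)\<^sup>2)" "i \<in> S" "j \<in> S"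
  shows "x i / a i = x j / a j"
proof (cases "i = j")
  case False
  have nn: "0 \<le> q i j * a i * a j * (x i / a i - x j / a j)\<^sup>2" if "i \<in> S" "j \<in> S - {i}" for i j
    using q_pos[of i j] a_pos[of i] a_pos[of j] that
    by (intro mult_nonneg_nonneg) (auto intro: less_imp_le simp del: lperm.simps)
  have "(\<Sum>i\<in>S. \<Sum>j\<in>S-{i}. q i j * a i * a j * (x i / a i - x j / a j)\<^sup>2) = 0"
    using perron_identity[of x] assms(1) by (simp del: lperm.simps)
  then have "(\<Sum>j\<in>S-{i}. q i j * a i * a j * (x i / a i - x j / a j)\<^sup>2) = 0"
    using fin assms(2) nn by (subst (asm) sum_nonneg_eq_0_iff) (auto intro!: sum_nonneg simp del: lperm.simps)
  then have "q i j * a i * a j * (x i / a i - x j / a j)\<^sup>2 = 0"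
    using fin assms False nn by (subst (asm) sum_nonneg_eq_0_iff) (auto simp del: lperm.simps)
  then show ?thesis
    using q_pos[OF assms(2,3) False] a_pos[of i] a_pos[of j] by (simp del: lperm.simps)
qed simp

text \<open>Fredholm alternative for \<open>1 - T\<close>, whose kernel is spanned by
  \<open>a\<close>: \<open>B y a\<close> is the \<open>w\<close>-weighted inner product of
  \<open>y\<close> and \<open>a\<close>, so the hypothesis says that \<open>y\<close> is orthogonal
  to the kernel.\<close>

private lemma solve_one_minus_T:
  assumes "B y a = 0"
  obtains x where "\<And>i. i \<in> S \<Longrightarrow> w i * x i - G i x = w i * y i"
proof -
  \<comment> \<open>Adding the rank-one matrix of \<open>p\<close> removes the kernel, since
    \<open>p\<close> pairs positively with \<open>a\<close>. For the solution found, the added term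
    is shown to vanish.\<close>
  define K where "K i j = (if i = j then w i else - q i j) + p i * p j" for i j
  have Kx: "(\<Sum>j\<in>S. K i j * x j) = w i * x i - G i x + p i * (\<Sum>j\<in>S. p j * x j)" if "i \<in> S" for i x
  proof -
    have "(\<Sum>j\<in>S. K i j * x j) = (\<Sum>j\<in>S. (if i = j then w i else - q i j) * x j) + p i * (\<Sum>j\<in>S. p j * x j)"
      by (simp add: K_def sum.distrib sum_distrib_left algebra_simps del: lperm.simps)
    also have "(\<Sum>j\<in>S. (if i = j then w i else - q i j) * x j)
       = w i * x i + (\<Sum>j\<in>S-{i}. (if i = j then w i else - q i j) * x j)"
      by (subst sum.remove[OF fin that]) simp
    also have "(\<Sum>j\<in>S-{i}. (if i = j then w i else - q i j) * x j) = - G i x"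
      unfolding G_eq sum_negf[symmetric] by (intro sum.cong) auto
    finally show ?thesis by simp
  qed
  have pa: "w i * a i = p i" for i using a_pos[of i] by simp
  have "\<exists>x. \<forall>i\<in>S. (\<Sum>j\<in>S. K i j * x j) = w i * y i"
  proof (rule linear_system_solvable[OF fin])
    fix x i
    assume *: "\<And>i. i \<in> S \<Longrightarrow> (\<Sum>j\<in>S. K i j * x j) = 0" and i: "i \<in> S"
    \<comment> \<open>Pairing the homogeneous system with \<open>x\<close> writes zero as a sum of
      two non-negative terms.\<close>
    have "0 = (\<Sum>i\<in>S. x i * (w i * x i - G i x + p i * (\<Sum>j\<in>S. p j * x j)))"
      using * Kx by (intro sum.neutral[symmetric]) simp
    also have "\<dots> = (\<Sum>i\<in>S. w i * (x i)\<^sup>2) - B x x + (\<Sum>j\<in>S. p j * x j)\<^sup>2"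
      unfolding B_eq by (simp add: sum.distrib sum_subtractf power2_eq_square sum_distrib_right
          algebra_simps del: lperm.simps)
    finally have z: "(\<Sum>i\<in>S. w i * (x i)\<^sup>2) - B x x + (\<Sum>j\<in>S. p j * x j)\<^sup>2 = 0" by simp
    have eq: "B x x = (\<Sum>i\<in>S. w i * (x i)\<^sup>2)" and px: "(\<Sum>j\<in>S. p j * x j) = 0"
      using z perron_nonneg[of x] zero_le_power2[of "\<Sum>j\<in>S. p j * x j"]
      by (linarith, smt (verit) power2_eq_iff_nonneg power_zero_numeral zero_eq_power2)
    define s where "s = x i / a i"
    have xs: "x j = s * a j" if "j \<in> S" for j
      using perron_equality[OF eq that i] a_pos[of j] by (simp add: s_def field_simps)
    have "s * (\<Sum>j\<in>S. p j * a j) = 0"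
      using px xs by (simp add: sum_distrib_left mult_ac cong: sum.cong del: lperm.simps)
    moreover have "0 < (\<Sum>j\<in>S. p j * a j)"
      using fin i p_pos a_pos by (intro sum_pos) auto
    ultimately show "x i = 0" using xs[OF i] by simp
  qed
  then obtain x where "\<forall>i\<in>S. (\<Sum>j\<in>S. K i j * x j) = w i * y i" by blast
  then have x: "w i * x i - G i x + p i * (\<Sum>j\<in>S. p j * x j) = w i * y i" if "i \<in> S" for i
    using Kx[OF that, of x] that by (simp del: lperm.simps)
  \<comment> \<open>Pairing with \<open>a\<close> annihilates \<open>(1 - T) x\<close> and the
    right-hand side, leaving only the rank-one term.\<close>
  have "(\<Sum>i\<in>S. a i * (w i * x i - G i x + p i * (\<Sum>j\<in>S. p j * x j))) = (\<Sum>i\<in>S. a i * (w i * y i))"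
    using x by simp
  moreover have "(\<Sum>i\<in>S. a i * (w i * y i)) = B y a" for y
    unfolding B_eq using a_pos by (intro sum.cong refl) (simp add: less_imp_neq[symmetric] del: lperm.simps)
  moreover have "(\<Sum>i\<in>S. a i * G i x) = B x a"
    using B_sym[of a x] by simp
  ultimately have *: "(\<Sum>i\<in>S. a i * p i) * (\<Sum>j\<in>S. p j * x j) = 0"
    using assms by (simp add: distrib_left right_diff_distrib sum.distrib sum_subtractf sum_distrib_right
        mult.assoc[symmetric] del: lperm.simps)
  have "S \<noteq> {}" using card by auto
  then have "0 < (\<Sum>i\<in>S. a i * p i)"
    using fin p_pos a_pos by (intro sum_pos) auto
  with * have "(\<Sum>j\<in>S. p j * x j) = 0" by simp
  then show thesis
    using x by (intro that[of x]) (simp del: lperm.simps)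
qed

text \<open>On the complement of \<open>a\<close>, \<open>N = 1 - T\<close> is positive with \<open>N\<^sup>2 \<ge> N\<close>, so \<open>N \<ge> 1\<close> and \<open>T \<le> 0\<close>.\<close>

lemma lperm_hyperbolic:
  assumes "B y a = 0"
  shows "B y y \<le> 0"
proof -
  \<comment> \<open>With \<open>y = N x\<close>, the values \<open>E x y\<close> and
    \<open>E y y\<close> below are those of the forms of \<open>N\<close> and of its square at
    \<open>x\<close>.\<close>
  obtain x where x: "\<And>i. i \<in> S \<Longrightarrow> w i * x i - G i x = w i * y i"
    using solve_one_minus_T[OF assms] by blast
  have Gx: "G i x = w i * (x i - y i)" if "i \<in> S" for i
    unfolding right_diff_distrib using x[OF that] by linarith
  define E where "E u v = (\<Sum>i\<in>S. w i * (u i * v i))" for u v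
  have Bzx: "B z x = E z x - E z y" for z
  proof -
    have "B z x = (\<Sum>i\<in>S. z i * (w i * (x i - y i)))"
      unfolding B_eq using Gx by (intro sum.cong refl) (simp only:)
    then show ?thesis
      by (simp only: E_def sum_subtractf left_diff_distrib right_diff_distrib mult_ac)
  qed
  have "E y x = E x y" by (simp only: E_def mult_ac)
  with Bzx have Bx: "B x x = E x x - E x y" and Byx: "B y x = E x y - E y y"
    by simp_all
  have "(\<Sum>i\<in>S. (G i x)\<^sup>2 / w i) = E x x - 2 * E x y + E y y"
  proof -
    have expand: "(W * (r - s))\<^sup>2 / W = W * (r * r) - 2 * (W * (r * s)) + W * (s * s)"
      if "W \<noteq> 0" for W r s :: real
      using that by (simp add: power2_eq_square field_simps)
    have "(\<Sum>i\<in>S. (G i x)\<^sup>2 / w i) = (\<Sum>i\<in>S. w i * (x i * x i) - 2 * (w i * (x i * y i)) + w i * (y i * y i))"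
    proof (intro sum.cong refl)
      fix i assume i: "i \<in> S"
      show "(G i x)\<^sup>2 / w i = w i * (x i * x i) - 2 * (w i * (x i * y i)) + w i * (y i * y i)"
        unfolding Gx[OF i] by (rule expand[OF less_imp_neq[OF w_pos[OF i], symmetric]])
    qed
    then show ?thesis
      by (simp add: E_def sum.distrib sum_subtractf sum_distrib_left del: lperm.simps)
  qed
  then have "E x y \<le> E y y"
    using operator_square[of x] Bx by (simp del: lperm.simps)
  \<comment> \<open>The Perron bound at \<open>y - x = - T x\<close> gives
    \<open>B y y \<le> E x y - E y y\<close>, which is non-positive by the preceding inequality. The
    factor \<open>1\<close> matches \<open>lperm_combine_square\<close> at
    \<open>t = 1\<close>.\<close>
  moreover have "B (\<lambda>i. y i - 1 * x i) (\<lambda>i. y i - 1 * x i) \<le> (\<Sum>i\<in>S. w i * (y i - 1 * x i)\<^sup>2)"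
    by (rule perron_nonneg)
  moreover have "(\<Sum>i\<in>S. w i * (y i - 1 * x i)\<^sup>2) = E y y - 2 * E x y + E x x"
  proof -
    have "W * (s - 1 * r)\<^sup>2 = W * (s * s) - 2 * (W * (r * s)) + W * (r * r)" for W r s :: real
      by (simp add: power2_eq_square algebra_simps)
    then show ?thesis by (simp only: E_def sum.distrib sum_subtractf sum_distrib_left)
  qed
  ultimately show ?thesis
    unfolding lperm_combine_square[OF fin] using Bx Byx by (simp del: lperm.simps)
qed

end

text \<open>A reverse Cauchy-Schwarz inequality, by induction on the number of fixed columns.
  Subtracting a multiple of \<open>v\<close> makes \<open>u\<close> orthogonal to \<open>a\<close>,
  where the form is non-positive; completing the square gives the claim. With two rows the defect is
  the square of a determinant.\<close>

theorem lperm_alexandrov: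
  fixes S :: "'i set"
  assumes "finite S" "card S = length A + 2"
    and "\<And>v i. v \<in> set A \<Longrightarrow> 0 < v i" "\<And>i. 0 < v i"
  shows "lperm (u # u # A) S * lperm (v # v # A) S \<le> (lperm (u # v # A) S)\<^sup>2"
  using assms
proof (induction A arbitrary: S u v)
  case Nil
  then obtain i j where S: "S = {i, j}" "i \<noteq> j"
    using card_2_iff[of S] by auto
  have D: "{i, j} - {i} = {j}" "{i, j} - {j} = {i}" using S by auto
  have "(lperm [u, v] S)\<^sup>2 - lperm [u, u] S * lperm [v, v] S = (u i * v j - u j * v i)\<^sup>2"
    using S by (simp add: D power2_eq_square algebra_simps)
  then show ?case by (smt (verit) zero_le_power2)
next
  case (Cons a A)
  note fin = Cons.prems(1)
  let ?B = "\<lambda>u v. lperm (u # v # a # A) S"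
  have Bva: "0 < ?B v a" and Bvv: "0 < ?B v v"
    using Cons.prems by (auto intro!: lperm_pos simp del: lperm.simps)
  define s where "s = ?B u a / ?B v a"
  let ?z = "\<lambda>i. u i - s * v i"
  have "?B ?z a = 0"
    unfolding lperm_diff using Bva by (simp add: s_def del: lperm.simps)
  then have "?B ?z ?z \<le> 0"
    using Cons.prems by (intro lperm_hyperbolic Cons.IH) (auto simp del: lperm.simps)
  then have "?B u u - 2 * s * ?B u v + s\<^sup>2 * ?B v v \<le> 0"
    unfolding lperm_combine_square[OF fin] .
  then have "(?B u u - 2 * s * ?B u v + s\<^sup>2 * ?B v v) * ?B v v \<le> 0"
    using Bvv by (intro mult_nonpos_nonneg) simp_all
  moreover have "(?B u v)\<^sup>2 - ?B u u * ?B v v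
      = (?B u v - s * ?B v v)\<^sup>2 - (?B u u - 2 * s * ?B u v + s\<^sup>2 * ?B v v) * ?B v v"
    by (simp add: power2_eq_square algebra_simps del: lperm.simps)
  ultimately show ?case
    using zero_le_power2[of "?B u v - s * ?B v v"] by linarith
qed

section \<open>Elimination of a variable\<close>

text \<open>Log-concavity makes the successive quotients non-increasing, so each of the
  \<open>k\<close> factors of \<open>b k / b 0\<close> is at most the first.\<close>

lemma log_concave_power_bound:
  fixes b :: "nat \<Rightarrow> real"
  assumes pos: "\<And>j. j \<le> k \<Longrightarrow> 0 < b j"
    and lc: "\<And>j. j + 2 \<le> k \<Longrightarrow> b j * b (j + 2) \<le> (b (j + 1))\<^sup>2"
  shows "b k \<le> b 0 * (b 1 / b 0) ^ k"
proof -
  have ratio: "b (Suc j) * b 0 \<le> b j * b 1" if "Suc j \<le> k" for j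
    using that
  proof (induction j)
    case (Suc j)
    have p: "0 < b j" "0 < b (Suc j)" "0 < b 0" using pos Suc.prems by simp_all
    have "b j * (b (Suc (Suc j)) * b 0) \<le> (b (Suc j))\<^sup>2 * b 0"
      using lc[of j] Suc.prems p(3) by (simp add: mult.assoc[symmetric])
    also have "\<dots> = b (Suc j) * (b (Suc j) * b 0)" by (simp add: power2_eq_square)
    also have "\<dots> \<le> b (Suc j) * (b j * b 1)"
      using Suc p by (intro mult_left_mono) simp_all
    finally have "b j * (b (Suc (Suc j)) * b 0) \<le> b j * (b (Suc j) * b 1)" by (simp add: mult_ac)
    then show ?case using p by simp
  qed simp
  have "b j \<le> b 0 * (b 1 / b 0) ^ j" if "j \<le> k" for j
    using that
  proof (induction j)
    case (Suc j)
    have p: "0 < b 0" "0 < b 1" using pos[of 0] pos[of 1] Suc.prems by simp_all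
    have "b (Suc j) \<le> b j * (b 1 / b 0)"
      using ratio[OF Suc.prems] p by (simp add: field_simps)
    also have "\<dots> \<le> b 0 * (b 1 / b 0) ^ j * (b 1 / b 0)"
      using Suc p by (intro mult_right_mono) simp_all
    finally show ?case by (simp add: mult_ac)
  qed simp
  then show ?thesis by simp
qed

text \<open>For positive \<open>k\<close>, the reciprocal of the infimum of
  \<open>(1 + t / k) ^ k / t\<close> over \<open>t > 0\<close>; at \<open>k = 1\<close> it is
  \<open>0 ^ 0 = 1\<close>.\<close>

definition gurvits :: "nat \<Rightarrow> real" where
  "gurvits k = ((real k - 1) / real k) ^ (k - 1)"

lemma gurvits_1 [simp]: "gurvits (Suc 0) = 1"
  by (simp add: gurvits_def)

lemma gurvits_pos: "1 \<le> k \<Longrightarrow> 0 < gurvits k"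
  by (cases "k = 1") (auto simp: gurvits_def)

text \<open>The right-hand side divided by \<open>t\<close> is minimal at \<open>t = d b\<^sub>0 / ((d - 1) b\<^sub>1)\<close>.\<close>

lemma gurvits_slope_bound:
  assumes d: "1 \<le> d" and b: "0 < b0" "0 < b1"
    and le: "\<And>t. 0 < t \<Longrightarrow> C * t \<le> b0 * (1 + t * b1 / (real d * b0)) ^ d"
  shows "C * gurvits d \<le> b1"
proof (cases "d = 1")
  case True
  show ?thesis
  proof (rule ccontr)
    assume "\<not> C * gurvits d \<le> b1"
    then have Cb: "0 < C - b1" using True by simp
    \<comment> \<open>For \<open>d = 1\<close> the infimum is only approached as \<open>t\<close>
      grows; at this \<open>t\<close>, \<open>C * t\<close> exceeds \<open>b0 + t * b1\<close> by
      \<open>C - b1\<close>.\<close>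
    define t where "t = b0 / (C - b1) + 1"
    have t: "0 < t" using Cb b by (auto simp: t_def intro!: add_pos_pos)
    have "b0 * (1 + t * b1 / (real d * b0)) ^ d = b0 + t * b1"
      using True b by (simp add: distrib_left)
    then have "C * t \<le> b0 + t * b1" using le[OF t] by simp
    moreover have "(C - b1) * t = b0 + (C - b1)" using Cb by (simp add: t_def distrib_left)
    ultimately show False using Cb by (simp add: algebra_simps)
  qed
next
  case False
  define e where "e = real d - 1"
  have e: "0 < e" using d False by (simp add: e_def)
  define t where "t = real d * b0 / (e * b1)"
  have t: "0 < t" using d e b by (simp add: t_def)
  have "1 + t * b1 / (real d * b0) = real d / e"
    using e b d by (simp add: t_def field_simps) (simp add: e_def)
  then have "C * t \<le> b0 * (real d / e) ^ d" using le[OF t] by simp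
  also have "(real d / e) ^ d = (real d / e) ^ (d - 1) * (real d / e)"
    using power_minus_mult[of d "real d / e"] d by simp
  finally have le': "C * t \<le> b0 * ((real d / e) ^ (d - 1) * (real d / e))" .
  have r: "0 < real d * b0 / e" using d b e by simp
  have "C * (real d * b0 / e) = C * t * b1"
    using b by (simp add: t_def)
  also have "\<dots> \<le> b0 * ((real d / e) ^ (d - 1) * (real d / e)) * b1"
    using le' b by (intro mult_right_mono) simp_all
  also have "\<dots> = ((real d / e) ^ (d - 1) * b1) * (real d * b0 / e)"
    by simp
  finally have "C * (real d * b0 / e) \<le> ((real d / e) ^ (d - 1) * b1) * (real d * b0 / e)" .
  then have "C \<le> (real d / e) ^ (d - 1) * b1"
    using r by (rule mult_right_le_imp_le)
  then have "C * gurvits d \<le> (real d / e) ^ (d - 1) * b1 * gurvits d"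
    using gurvits_pos[OF d] by (intro mult_right_mono) simp_all
  also have "(real d / e) ^ (d - 1) * b1 * gurvits d = b1 * ((real d / e) ^ (d - 1) * (e / real d) ^ (d - 1))"
    by (simp only: gurvits_def e_def mult_ac)
  also have "\<dots> = b1 * ((real d / e) * (e / real d)) ^ (d - 1)"
    by (simp only: power_mult_distrib)
  also have "\<dots> = b1" using d e by simp
  finally show ?thesis .
qed

text \<open>Replacing the columns \<open>y\<close> by \<open>z\<close> one at a time gives a
  log-concave sequence, by Alexandrov's inequality.\<close>

lemma lperm_power_bound:
  assumes "finite S" "card S = length A + k" "1 \<le> k"
    and A: "\<And>v i. v \<in> set A \<Longrightarrow> 0 < v i" and y: "\<And>i. 0 < y i" and z: "\<And>i. 0 < z i"
  shows "lperm (replicate k z @ A) S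
    \<le> lperm (replicate k y @ A) S * (lperm (z # replicate (k - 1) y @ A) S / lperm (replicate k y @ A) S) ^ k"
proof -
  define b where "b j = lperm (replicate j z @ replicate (k - j) y @ A) S" for j
  have "b k \<le> b 0 * (b 1 / b 0) ^ k"
  proof (rule log_concave_power_bound)
    fix j assume "j \<le> k"
    then show "0 < b j"
      unfolding b_def using assms by (intro lperm_pos) auto
  next
    fix j assume "j + 2 \<le> k"
    then obtain m where m: "k = j + 2 + m" using le_Suc_ex by blast
    define R where "R = replicate j z @ replicate m y @ A"
    have "b j = lperm (y # y # R) S" "b (j + 1) = lperm (y # z # R) S" "b (j + 2) = lperm (z # z # R) S"
      unfolding b_def R_def m by (rule lperm_mset_cong[OF _ assms(1)]; simp add: numeral_2_eq_2)+
    then show "b j * b (j + 2) \<le> (b (j + 1))\<^sup>2"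
      using assms m by (auto intro!: lperm_alexandrov simp: R_def simp del: lperm.simps)
  qed
  then show ?thesis by (simp add: b_def del: lperm.simps)
qed

text \<open>One elimination: the conclusion bounds the derivative \<open>b1\<close> at
  \<open>t = 0\<close> of the right-hand side of \<open>le\<close>. With \<open>b0\<close> its value
  there, log-concavity bounds it by \<open>b0 * (1 + t * b1 / (k * b0)) ^ k\<close>, to which the
  slope bound applies.\<close>

lemma lperm_gurvits_step:
  assumes "finite S" "card S = length A + k" "1 \<le> k"
    and A: "\<And>v i. v \<in> set A \<Longrightarrow> 0 < v i" and y: "\<And>i. 0 < y i" and a: "\<And>i. 0 < a i"
    and le: "\<And>t. 0 < t \<Longrightarrow> C * t \<le> lperm (replicate k (\<lambda>i. y i + t * a i) @ A) S / fact k"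
  shows "C * gurvits k \<le> lperm (a # replicate (k - 1) y @ A) S / fact (k - 1)"
proof (rule gurvits_slope_bound[OF assms(3), where ?b0.0 = "lperm (replicate k y @ A) S / fact k"])
  define \<beta>0 where "\<beta>0 = lperm (replicate k y @ A) S"
  define \<beta>1 where "\<beta>1 = lperm (a # replicate (k - 1) y @ A) S"
  have p: "0 < \<beta>0" "0 < \<beta>1"
    unfolding \<beta>0_def \<beta>1_def using assms by (auto intro!: lperm_pos simp del: lperm.simps)
  then show "0 < lperm (replicate k y @ A) S / fact k" "0 < lperm (a # replicate (k - 1) y @ A) S / fact (k - 1)"
    unfolding \<beta>0_def \<beta>1_def by simp_all
  fix t :: real assume t: "0 < t"
  let ?z = "\<lambda>i. y i + t * a i"
  obtain m where k: "k = Suc m" using assms(3) by (cases k) auto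
  have fk: "(fact k :: real) = real k * fact (k - 1)" by (simp add: k)
  have "lperm (?z # replicate (k - 1) y @ A) S = \<beta>0 + t * \<beta>1"
    unfolding lperm_add by (simp add: \<beta>0_def \<beta>1_def k del: lperm.simps)
  moreover have "lperm (replicate k ?z @ A) S
    \<le> lperm (replicate k y @ A) S * (lperm (?z # replicate (k - 1) y @ A) S / lperm (replicate k y @ A) S) ^ k"
    using assms t by (intro lperm_power_bound) (auto intro: add_pos_pos)
  ultimately have "lperm (replicate k ?z @ A) S \<le> \<beta>0 * (1 + t * \<beta>1 / \<beta>0) ^ k"
    using p by (simp add: \<beta>0_def[symmetric] add_divide_distrib del: lperm.simps)
  then have "lperm (replicate k ?z @ A) S / fact k \<le> \<beta>0 / fact k * (1 + t * \<beta>1 / \<beta>0) ^ k"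
    by (simp add: divide_right_mono)
  also have "t * \<beta>1 / \<beta>0 = t * (\<beta>1 / fact (k - 1)) / (real k * (\<beta>0 / fact k))"
    using p assms(3) unfolding fk by simp
  finally show "C * t \<le> lperm (replicate k y @ A) S / fact k * (1 + t * (lperm (a # replicate (k - 1) y @ A) S / fact (k - 1)) /
        (real k * (lperm (replicate k y @ A) S / fact k))) ^ k"
    using le[OF t] unfolding \<beta>0_def \<beta>1_def by (rule order_trans[rotated])
qed

text \<open>In \<open>le\<close> the variables from \<open>k\<close> on have been eliminated and
  have left their columns behind. Eliminating \<open>x k\<close> passes from \<open>k + 1\<close>
  variables to \<open>k\<close> and moves the factor \<open>gurvits (Suc k)\<close> into
  \<open>C\<close>, until one variable remains.\<close>

lemma lperm_gurvits_chain:
  fixes a :: "nat \<Rightarrow> 'i \<Rightarrow> real"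
  assumes S: "finite S" "card S = n" and a: "\<And>j i. 0 < a j i" and k: "1 \<le> k" "k \<le> n"
    and le: "\<And>x. (\<And>j. 0 < x j) \<Longrightarrow>
      C * (\<Prod>j<k. x j) \<le> lperm (replicate k (\<lambda>i. \<Sum>j<k. x j * a j i) @ map a [k..<n]) S / fact k"
  shows "C * (\<Prod>j=1..k. gurvits j) \<le> lperm (map a [0..<n]) S"
  using k le
proof (induction k arbitrary: C rule: dec_induct)
  case base
  then show ?case
    using base(2)[of "\<lambda>_. 1"] by (simp add: upt_conv_Cons del: lperm.simps)
next
  case (step k)
  have "C * gurvits (Suc k) * (\<Prod>j=1..k. gurvits j) \<le> lperm (map a [0..<n]) S"
  proof (rule step.IH)
    show "k \<le> n" using step by simp
    fix x :: "nat \<Rightarrow> real" assume x: "\<And>j. 0 < x j"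
    let ?y = "\<lambda>i. \<Sum>j<k. x j * a j i"
    have "(C * (\<Prod>j<k. x j)) * gurvits (Suc k)
      \<le> lperm (a k # replicate (Suc k - 1) ?y @ map a [Suc k..<n]) S / fact (Suc k - 1)"
    proof (rule lperm_gurvits_step)
      fix t :: real assume t: "0 < t"
      show "C * (\<Prod>j<k. x j) * t \<le> lperm (replicate (Suc k) (\<lambda>i. ?y i + t * a k i) @ map a [Suc k..<n]) S / fact (Suc k)"
        using step.prems(2)[of "x(k := t)"] x t by (simp add: mult.assoc del: lperm.simps fact_Suc)
    next
      show "0 < ?y i" for i
        using x a step.hyps by (intro sum_pos mult_pos_pos) (auto simp: lessThan_empty_iff)
    qed (use S a step in auto)
    also have "lperm (a k # replicate (Suc k - 1) ?y @ map a [Suc k..<n]) S = lperm (replicate k ?y @ map a [k..<n]) S"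
      using step.prems by (intro lperm_mset_cong[OF _ S(1)]) (simp add: upt_conv_Cons)
    finally show "C * gurvits (Suc k) * (\<Prod>j<k. x j) \<le> lperm (replicate k ?y @ map a [k..<n]) S / fact k"
      by (simp add: mult_ac del: lperm.simps)
  qed
  then show ?case by (simp add: mult_ac del: lperm.simps)
qed

lemma prod_le_mean_power:
  fixes f :: "'i \<Rightarrow> real"
  assumes "finite S" "S \<noteq> {}" "\<And>i. i \<in> S \<Longrightarrow> 0 \<le> f i"
  shows "(\<Prod>i\<in>S. f i) \<le> ((\<Sum>i\<in>S. f i) / card S) ^ card S"
proof (cases "(\<Prod>i\<in>S. f i) = 0")
  case True
  show ?thesis unfolding True using assms by (simp add: sum_nonneg)
next
  case False
  then have "0 < f i" if "i \<in> S" for i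
    using assms that by (metis less_le prod_zero_iff)
  then have P: "0 < (\<Prod>i\<in>S. f i)" by (rule prod_pos)
  have c: "0 < card S" using assms by (simp add: card_gt_0_iff)
  have "(\<Prod>i\<in>S. f i) = ((\<Prod>i\<in>S. f i) powr (1 / card S)) ^ card S"
    using P c by (simp add: powr_power)
  also have "\<dots> \<le> ((\<Sum>i\<in>S. f i) / card S) ^ card S"
    using arith_geom_mean[OF assms] by (intro power_mono) (simp_all add: sum_divide_distrib)
  finally show ?thesis .
qed

text \<open>A zero entry makes one linear factor constant, so AM-GM is applied to \<open>d\<close> factors instead of \<open>d + 1\<close>.\<close>

lemma gurvits_first_step:
  assumes S: "finite S" "card S = Suc d" "1 \<le> d" and i0: "i0 \<in> S" "a i0 = 0"
    and y: "\<And>i. i \<in> S \<Longrightarrow> 0 < y i" and a: "\<And>i. i \<in> S \<Longrightarrow> 0 \<le> a i" "i1 \<in> S" "0 < a i1"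
    and le: "\<And>t. 0 < t \<Longrightarrow> C * t \<le> (\<Prod>i\<in>S. y i + t * a i)"
  shows "C * gurvits d \<le> (\<Sum>i\<in>S. a i * (\<Prod>j\<in>S - {i}. y j))"
proof -
  define b0 where "b0 = (\<Prod>i\<in>S. y i)"
  \<comment> \<open>The logarithmic derivative of the product at \<open>t = 0\<close>, so that
    \<open>b0 * r\<close> is the sum in the conclusion.\<close>
  define r where "r = (\<Sum>i\<in>S. a i / y i)"
  have b0: "0 < b0" unfolding b0_def using y by (intro prod_pos) auto
  have "0 < a i1 / y i1" using a y by simp
  also have "\<dots> \<le> r"
    unfolding r_def using S(1) a y by (intro member_le_sum) (auto intro: divide_nonneg_pos)
  finally have r: "0 < r" .
  have b1: "(\<Sum>i\<in>S. a i * (\<Prod>j\<in>S - {i}. y j)) = b0 * r"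
    unfolding r_def sum_distrib_left b0_def
  proof (intro sum.cong refl)
    fix i assume i: "i \<in> S"
    then show "a i * (\<Prod>j\<in>S - {i}. y j) = (\<Prod>i\<in>S. y i) * (a i / y i)"
      using y[OF i] by (simp add: prod.remove[OF S(1) i])
  qed
  have "C * gurvits d \<le> b0 * r"
  proof (rule gurvits_slope_bound[OF S(3) b0])
    fix t :: real assume t: "0 < t"
    let ?f = "\<lambda>i. 1 + t * (a i / y i)"
    have cd: "card (S - {i0}) = d" using S i0 by simp
    have "(\<Prod>i\<in>S. y i + t * a i) = (\<Prod>i\<in>S. y i * ?f i)"
      using y by (intro prod.cong refl) (simp add: field_simps less_imp_neq[symmetric])
    also have "\<dots> = b0 * (\<Prod>i\<in>S - {i0}. ?f i)"
      using prod.remove[OF S(1) i0(1), of ?f] i0(2) by (simp add: b0_def prod.distrib)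
    also have "(\<Prod>i\<in>S - {i0}. ?f i) \<le> ((\<Sum>i\<in>S - {i0}. ?f i) / card (S - {i0})) ^ card (S - {i0})"
      using S i0 a y t cd by (intro prod_le_mean_power) (auto intro!: add_nonneg_nonneg divide_nonneg_pos mult_nonneg_nonneg)
    also have "(\<Sum>i\<in>S - {i0}. ?f i) = real d + t * r"
      using cd by (simp add: sum.distrib r_def sum.remove[OF S(1) i0(1)] i0(2) sum_distrib_left)
    also have "(real d + t * r) / card (S - {i0}) = 1 + t * r / real d"
      using S(3) cd by (simp add: add_divide_distrib)
    finally have "(\<Prod>i\<in>S. y i + t * a i) \<le> b0 * (1 + t * r / real d) ^ d"
      using b0 cd by simp
    then show "C * t \<le> b0 * (1 + t * (b0 * r) / (real d * b0)) ^ d"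
      using le[OF t] b0 by simp
  qed (use b0 r in simp)
  then show ?thesis unfolding b1 .
qed

section \<open>Permanents of matrices with a zero entry\<close>

lemma lperm_permutations:
  assumes "finite S" "card S = length vs"
  shows "lperm vs S = (\<Sum>l\<in>permutations_of_set S. \<Prod>k<length vs. (vs ! k) (l ! k))"
  using assms
proof (induction vs arbitrary: S)
  case (Cons v vs)
  have ne: "S \<noteq> {}" using Cons.prems(2) by auto
  have "(\<Sum>l\<in>permutations_of_set S. \<Prod>k<length (v # vs). ((v # vs) ! k) (l ! k))
    = (\<Sum>i\<in>S. \<Sum>l\<in>(#) i ` permutations_of_set (S - {i}). \<Prod>k<length (v # vs). ((v # vs) ! k) (l ! k))"
    unfolding permutations_of_set_nonempty[OF ne]
    using Cons.prems by (intro sum.UNION_disjoint) auto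
  also have "\<dots> = (\<Sum>i\<in>S. v i * lperm vs (S - {i}))"
  proof (intro sum.cong refl)
    fix i assume i: "i \<in> S"
    have "(\<Sum>l\<in>(#) i ` permutations_of_set (S - {i}). \<Prod>k<length (v # vs). ((v # vs) ! k) (l ! k))
      = (\<Sum>l\<in>permutations_of_set (S - {i}). v i * (\<Prod>k<length vs. (vs ! k) (l ! k)))"
      by (subst sum.reindex) (auto simp: prod.lessThan_Suc_shift simp del: prod.lessThan_Suc)
    also have "\<dots> = v i * lperm vs (S - {i})"
      using Cons.IH[of "S - {i}"] Cons.prems i by (simp add: sum_distrib_left)
    finally show "(\<Sum>l\<in>(#) i ` permutations_of_set (S - {i}). \<Prod>k<length (v # vs). ((v # vs) ! k) (l ! k))
      = v i * lperm vs (S - {i})" .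
  qed
  finally show ?case by simp
qed simp

text \<open>\<open>permanent\<close> assigns columns to rows and \<open>lperm\<close> rows to
  columns, hence the passage to inverses; a permutation is then read as its list of values.\<close>

lemma permanent_eq_lperm:
  assumes M: "M \<in> carrier_mat n n"
  shows "permanent M = lperm (map (\<lambda>j i. M $$ (i, j)) [0..<n]) {0..<n}"
proof -
  have "permanent M = (\<Sum>p | p permutes {0..<n}. \<Prod>i = 0..<n. M $$ (i, Hilbert_Choice.inv p i))"
    using M unfolding permanent_def by (subst sum_permutations_inverse) simp
  also have "\<dots> = (\<Sum>p | p permutes {0..<n}. \<Prod>i = 0..<n. M $$ (p i, i))"
  proof (intro sum.cong refl)
    fix p assume "p \<in> {p. p permutes {0..<n}}"
    then have p: "p permutes {0..<n}" by simp
    have "(\<Prod>i = 0..<n. M $$ (i, Hilbert_Choice.inv p i)) = (\<Prod>i = 0..<n. M $$ (p i, Hilbert_Choice.inv p (p i)))"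
      using prod.permute[OF p, of "\<lambda>i. M $$ (i, Hilbert_Choice.inv p i)"] by (simp add: o_def)
    then show "(\<Prod>i = 0..<n. M $$ (i, Hilbert_Choice.inv p i)) = (\<Prod>i = 0..<n. M $$ (p i, i))"
      using permutes_inverses(2)[OF p] by simp
  qed
  also have "\<dots> = (\<Sum>l\<in>permutations_of_set {0..<n}. \<Prod>k<n. M $$ (l ! k, k))"
  proof (rule sum.reindex_bij_witness[where j = "\<lambda>p. map p [0..<n]" and i = "\<lambda>l i. if i < n then l ! i else i"])
    fix l assume "l \<in> permutations_of_set {0..<n}"
    then have l: "set l = {0..<n}" "distinct l" by (auto dest: permutations_of_setD)
    then have len: "length l = n" using distinct_card[of l] by simp
    have "bij_betw ((!) l) {0..<n} {0..<n}"
      using bij_betw_nth[OF l(2) refl refl] by (simp only: l(1) len lessThan_atLeast0)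
    then have "bij_betw (\<lambda>i. if i < n then l ! i else i) {0..<n} {0..<n}"
      by (rule bij_betw_cong[THEN iffD1, rotated]) simp
    then show "(\<lambda>i. if i < n then l ! i else i) \<in> {p. p permutes {0..<n}}"
      by (intro CollectI bij_imp_permutes) auto
    show "map (\<lambda>i. if i < n then l ! i else i) [0..<n] = l"
      using len by (intro nth_equalityI) auto
  next
    fix p assume "p \<in> {p. p permutes {0..<n}}"
    then have p: "p permutes {0..<n}" by simp
    show "(\<lambda>i. if i < n then map p [0..<n] ! i else i) = p"
      using permutes_not_in[OF p] by auto
    show "map p [0..<n] \<in> permutations_of_set {0..<n}"
      using permutes_image[OF p] permutes_inj_on[OF p] by (auto simp: permutations_of_set_def distinct_map)
    show "(\<Prod>k<n. M $$ (map p [0..<n] ! k, k)) = (\<Prod>i = 0..<n. M $$ (p i, i))"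
      by (simp add: lessThan_atLeast0)
  qed
  also have "\<dots> = lperm (map (\<lambda>j i. M $$ (i, j)) [0..<n]) {0..<n}"
    by (subst lperm_permutations) auto
  finally show ?thesis .
qed

text \<open>Elimination asks for positive columns; adding a small constant to all entries supplies
  them, and this limit removes it again.\<close>

lemma tendsto_lperm_shift:
  "((\<lambda>\<delta>. lperm (map (\<lambda>j i. m i j + \<delta>) js) S) \<longlongrightarrow> lperm (map (\<lambda>j i. m i j) js) S) (at_right 0)"
  for m :: "'i \<Rightarrow> 'j \<Rightarrow> real"
proof (induction js arbitrary: S)
  case (Cons j js)
  have "((\<lambda>\<delta>. m i j + \<delta>) \<longlongrightarrow> m i j) (at_right 0)" for i
    by (rule tendsto_eq_intros | simp)+
  with Cons show ?case by (auto intro!: tendsto_sum tendsto_mult)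
qed simp

text \<open>The first elimination exploits the zero entry and costs \<open>gurvits d\<close> in
  place of \<open>gurvits (Suc d)\<close>; the chain then eliminates the other \<open>d\<close>
  variables. Hence \<open>gurvits d\<close> occurs twice.\<close>

lemma lperm_zero_entry_bound_last:
  fixes m :: "nat \<Rightarrow> nat \<Rightarrow> real"
  assumes d: "1 \<le> d" and nonneg: "\<And>i j. 0 \<le> m i j"
    and i0: "i0 \<le> d" "m i0 d = 0" and i1: "i1 \<le> d" "0 < m i1 d"
    and cap: "\<And>x. (\<And>j. 0 < x j) \<Longrightarrow> L * (\<Prod>j<Suc d. x j) \<le> (\<Prod>i = 0..<Suc d. \<Sum>j<Suc d. m i j * x j)"
  shows "L * gurvits d * (\<Prod>k=1..d. gurvits k) \<le> lperm (map (\<lambda>j i. m i j) [0..<Suc d]) {0..<Suc d}"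
proof -
  have *: "L * gurvits d * (\<Prod>k=1..d. gurvits k) \<le> lperm (map (\<lambda>j i. m i j + \<delta>) [0..<Suc d]) {0..<Suc d}"
    if \<delta>: "0 < \<delta>" for \<delta>
  proof (rule lperm_gurvits_chain)
    show "0 < m i j + \<delta>" for i j using nonneg[of i j] \<delta> by simp
    fix x :: "nat \<Rightarrow> real" assume x: "\<And>j. 0 < x j"
    define y where "y i = (\<Sum>j<d. x j * (m i j + \<delta>))" for i
    have y: "0 < y i" for i
      unfolding y_def using x nonneg \<delta> d
      by (intro sum_pos mult_pos_pos) (auto simp: lessThan_empty_iff intro: add_nonneg_pos)
    \<comment> \<open>The last column stays unshifted here to keep its zero entry; its shift is
      added afterwards and only increases the sum.\<close>
    have "(L * (\<Prod>j<d. x j)) * gurvits d \<le> (\<Sum>i\<in>{0..<Suc d}. m i d * (\<Prod>j\<in>{0..<Suc d} - {i}. y j))"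
    proof (rule gurvits_first_step[where ?i0.0 = i0 and ?i1.0 = i1])
      fix t :: real assume t: "0 < t"
      have "L * (\<Prod>j<d. x j) * t \<le> (\<Prod>i = 0..<Suc d. (\<Sum>j<d. m i j * x j) + m i d * t)"
        using cap[of "x(d := t)"] x t by (simp add: mult.assoc)
      also have "\<dots> \<le> (\<Prod>i = 0..<Suc d. y i + t * m i d)"
        unfolding y_def using x t nonneg \<delta>
        by (intro prod_mono) (auto intro!: add_mono sum_mono add_nonneg_nonneg sum_nonneg
            simp: mult.commute less_imp_le mult_left_mono)
      finally show "L * (\<Prod>j<d. x j) * t \<le> (\<Prod>i = 0..<Suc d. y i + t * m i d)" .
    qed (use d i0 i1 y nonneg in auto)
    also have "\<dots> \<le> (\<Sum>i\<in>{0..<Suc d}. (m i d + \<delta>) * (\<Prod>j\<in>{0..<Suc d} - {i}. y j))"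
      using y \<delta> by (intro sum_mono mult_right_mono prod_nonneg) (auto intro: less_imp_le)
    also have "\<dots> = lperm ((\<lambda>i. m i d + \<delta>) # replicate d y) {0..<Suc d} / fact d"
    proof -
      have "(m i d + \<delta>) * lperm (replicate d y) ({0..<Suc d} - {i})
        = fact d * ((m i d + \<delta>) * (\<Prod>j\<in>{0..<Suc d} - {i}. y j))" if "i \<in> {0..<Suc d}" for i
        using that by (subst lperm_replicate) auto
      then have "lperm ((\<lambda>i. m i d + \<delta>) # replicate d y) {0..<Suc d}
        = (\<Sum>i\<in>{0..<Suc d}. fact d * ((m i d + \<delta>) * (\<Prod>j\<in>{0..<Suc d} - {i}. y j)))"
        unfolding lperm.simps by (rule sum.cong[OF refl])
      then show ?thesis
        by (simp only: sum_distrib_left[symmetric]) simp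
    qed
    also have "lperm ((\<lambda>i. m i d + \<delta>) # replicate d y) {0..<Suc d}
      = lperm (replicate d y @ map (\<lambda>j i. m i j + \<delta>) [d..<Suc d]) {0..<Suc d}"
      by (rule lperm_mset_cong) auto
    finally show "L * gurvits d * (\<Prod>j<d. x j)
      \<le> lperm (replicate d (\<lambda>i. \<Sum>j<d. x j * (m i j + \<delta>)) @ map (\<lambda>j i. m i j + \<delta>) [d..<Suc d]) {0..<Suc d} / fact d"
      unfolding y_def by (simp only: mult_ac)
  qed (use d in auto)
  show ?thesis
    by (rule tendsto_lowerbound[OF tendsto_lperm_shift])
       (use * in \<open>auto intro: eventually_at_right_less[THEN eventually_mono] simp del: upt_Suc\<close>)
qed

text \<open>A transposition moves the column with the zero to the end, which changes neither the
  permanent nor the form of the capacity bound.\<close>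

lemma lperm_zero_entry_bound:
  fixes m :: "nat \<Rightarrow> nat \<Rightarrow> real"
  assumes n: "2 \<le> n" and nonneg: "\<And>i j. 0 \<le> m i j" and j0: "j0 < n"
    and i0: "i0 < n" "m i0 j0 = 0" and i1: "i1 < n" "0 < m i1 j0"
    and cap: "\<And>x. (\<And>j. 0 < x j) \<Longrightarrow> L * (\<Prod>j<n. x j) \<le> (\<Prod>i = 0..<n. \<Sum>j<n. m i j * x j)"
  shows "L * gurvits (n - 1) * (\<Prod>k=1..n - 1. gurvits k) \<le> lperm (map (\<lambda>j i. m i j) [0..<n]) {0..<n}"
proof -
  obtain d where d: "n = Suc d" "1 \<le> d" using n by (cases n) auto
  define \<pi> where "\<pi> = Transposition.transpose j0 d"
  have \<pi>: "\<pi> permutes {..<n}" unfolding \<pi>_def using j0 d by (intro permutes_swap_id) auto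
  have "L * gurvits d * (\<Prod>k=1..d. gurvits k) \<le> lperm (map (\<lambda>j i. m i (\<pi> j)) [0..<Suc d]) {0..<Suc d}"
  proof (rule lperm_zero_entry_bound_last[where m = "\<lambda>i j. m i (\<pi> j)" and ?i0.0 = i0 and ?i1.0 = i1])
    fix x :: "nat \<Rightarrow> real" assume x: "\<And>j. 0 < x j"
    have inv: "\<pi> (\<pi> j) = j" for j by (simp add: \<pi>_def)
    have "L * (\<Prod>j<n. x (\<pi> j)) \<le> (\<Prod>i = 0..<n. \<Sum>j<n. m i j * x (\<pi> j))"
      using x by (intro cap) auto
    moreover have "(\<Prod>j<n. x (\<pi> j)) = (\<Prod>j<n. x j)"
      using prod.permute[OF \<pi>, of x] by (simp add: o_def)
    moreover have "(\<Sum>j<n. m i j * x (\<pi> j)) = (\<Sum>j<n. m i (\<pi> j) * x j)" for i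
      using sum.permute[OF \<pi>, of "\<lambda>j. m i j * x (\<pi> j)"] by (simp add: o_def inv)
    ultimately show "L * (\<Prod>j<Suc d. x j) \<le> (\<Prod>i = 0..<Suc d. \<Sum>j<Suc d. m i (\<pi> j) * x j)"
      unfolding d(1) by simp
  qed (use d i0 i1 nonneg in \<open>auto simp: \<pi>_def\<close>)
  also have "map (\<lambda>j i. m i (\<pi> j)) [0..<Suc d] = map (\<lambda>j i. m i j) (map \<pi> [0..<n])"
    by (simp add: d(1))
  also have "lperm \<dots> {0..<Suc d} = lperm (map (\<lambda>j i. m i j) [0..<n]) {0..<Suc d}"
  proof (rule lperm_mset_cong)
    have "mset (map \<pi> [0..<n]) = mset [0..<n]"
      using permutes_image[OF \<pi>] permutes_inj_on[OF \<pi>]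
      by (intro set_eq_iff_mset_eq_distinct[THEN iffD1]) (auto simp: distinct_map lessThan_atLeast0)
    then show "mset (map (\<lambda>j i. m i j) (map \<pi> [0..<n])) = mset (map (\<lambda>j i. m i j) [0..<n])"
      by (metis mset_map)
  qed simp
  finally show ?thesis by (simp add: d(1))
qed

section \<open>The constants in the permanent bounds\<close>

lemma prod_gurvits:
  assumes "1 \<le> n"
  shows "(\<Prod>k=1..n. gurvits k) = fact n / real n ^ n"
  using assms
proof (induction n rule: dec_induct)
  case (step n)
  \<comment> \<open>The new factor \<open>(n / (n + 1)) ^ n\<close> cancels the old denominator
    \<open>n ^ n\<close>.\<close>
  then have "(\<Prod>k=1..Suc n. gurvits k) = fact n / real n ^ n * (real n / real (Suc n)) ^ n"
    by (simp add: gurvits_def)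
  also have "\<dots> = fact (Suc n) / real (Suc n) ^ Suc n"
    using step.hyps by (simp add: power_divide del: of_nat_Suc)
  finally show ?case .
qed simp

text \<open>Identifies the gain from one zero entry with the constant of the theorem; at
  \<open>n = 2\<close> the factor \<open>0 ^ 0 = 1\<close> occurs.\<close>

lemma gurvits_ratio:
  assumes "2 \<le> n"
  shows "gurvits (n - 1) / gurvits n = real (n - 2) ^ (n - 2) * real n ^ (n - 1) / real (n - 1) ^ (2 * n - 3)"
proof -
  obtain m where n: "n = m + 2" using assms le_Suc_ex by (metis add.commute)
  have e: "2 * n - 3 = m + (m + 1)" by (simp add: n)
  show ?thesis
    unfolding e by (simp add: n gurvits_def power_divide power_add add.commute)
qed

text \<open>With \<open>q = n - 1\<close>, Bernoulli's inequality for powers of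
  \<open>1 - 1 / q ^ 2\<close>, which factors as \<open>(q + 1) / q * ((q - 1) / q)\<close>, gives
  the claim after division by \<open>(q - 1) / q\<close>. That quotient vanishes for
  \<open>n = 2\<close>, which is treated directly.\<close>

lemma gurvits_strict_decreasing:
  assumes "2 \<le> n"
  shows "gurvits n < gurvits (n - 1)"
proof (cases "n = 2")
  case False
  obtain k where n: "n = Suc k" "2 \<le> k" using assms False by (cases n) auto
  define q where "q = real k"
  have q: "2 \<le> q" using n by (simp add: q_def)
  have "q < q * q" using mult_strict_right_mono[of 1 q q] q by simp
  then have qq: "1 < q * q" "q - 1 < q * q" using q by linarith+
  define z where "z = 1 / q\<^sup>2"
  have z: "0 < z" "z < 1" "(q - 1) * z < 1"
    using q qq by (simp_all add: z_def power2_eq_square)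
  obtain m where k: "k = Suc m" using n by (cases k) auto
  \<comment> \<open>Splitting off one factor before applying Bernoulli's inequality leaves the
    surplus \<open>(q - 1) * z * z\<close>, which makes the bound strict.\<close>
  have "1 - q * z < (1 - (q - 1) * z) * (1 - z)"
    using z q by (simp add: algebra_simps)
  also have "\<dots> \<le> (1 - z) ^ m * (1 - z)"
    using Bernoulli_inequality[of "-z" m] z by (intro mult_right_mono) (simp_all add: q_def k)
  finally have B: "1 - q * z < (1 - z) ^ k" by (simp add: k mult.commute)
  have z1: "1 - z = (q + 1) / q * ((q - 1) / q)" and z2: "1 - q * z = (q - 1) / q"
    using q by (simp_all add: z_def field_simps power2_eq_square)
  have r: "0 < (q - 1) / q" "0 < q / (q + 1)" using q by simp_all
  have "(q - 1) / q < ((q + 1) / q) ^ k * ((q - 1) / q) ^ m * ((q - 1) / q)"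
    using B unfolding z1 z2 by (simp only: power_mult_distrib k power_Suc2 mult_ac)
  then have "1 < ((q + 1) / q) ^ k * ((q - 1) / q) ^ m"
    using r(1) by (metis mult_less_cancel_right_pos mult_1)
  then have "(q / (q + 1)) ^ k * 1 < (q / (q + 1)) ^ k * (((q + 1) / q) ^ k * ((q - 1) / q) ^ m)"
    using r(2) by (intro mult_strict_left_mono) simp_all
  also have "\<dots> = (q / (q + 1) * ((q + 1) / q)) ^ k * ((q - 1) / q) ^ m"
    by (simp only: power_mult_distrib mult.assoc)
  also have "q / (q + 1) * ((q + 1) / q) = 1" using q by simp
  finally show ?thesis by (simp add: gurvits_def n q_def k add.commute)
qed (simp add: gurvits_def)

section \<open>Matrices with prescribed row and column sums\<close>

lemma Mat_setD:
  assumes "M \<in> Mat_set n c"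
  shows "M \<in> carrier_mat n n" "dim_row M = n" "dim_col M = n"
    and "\<And>i j. i < n \<Longrightarrow> j < n \<Longrightarrow> 0 \<le> M $$ (i, j)"
    and "\<And>i. i < n \<Longrightarrow> (\<Sum>j = 0..<n. M $$ (i, j)) = 1"
    and "\<And>j. j < n \<Longrightarrow> (\<Sum>i = 0..<n. M $$ (i, j)) = c $ j"
  using assms unfolding Mat_set_def by auto

lemma Mat_set_entry_le_1:
  assumes "M \<in> Mat_set n c" "i < n" "j < n"
  shows "M $$ (i, j) \<le> 1"
proof -
  have "M $$ (i, j) \<le> (\<Sum>j = 0..<n. M $$ (i, j))"
    using assms Mat_setD(4)[OF assms(1,2)] by (intro member_le_sum) auto
  then show ?thesis using Mat_setD(5)[OF assms(1,2)] by simp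
qed

abbreviation (input) uniform_mat :: "nat \<Rightarrow> real vec \<Rightarrow> real mat" where
  "uniform_mat n c \<equiv> (1 / real n) \<cdot>\<^sub>m outer_prod (ones_vec n) c"

lemma uniform_mat_entry:
  assumes "c \<in> carrier_vec n" "i < n" "j < n"
  shows "uniform_mat n c $$ (i, j) = c $ j / real n"
  using assms by (simp add: outer_prod_def ones_vec_def)

lemma uniform_mat_carrier: "c \<in> carrier_vec n \<Longrightarrow> uniform_mat n c \<in> carrier_mat n n"
  by (auto simp: outer_prod_def ones_vec_def)

lemma uniform_mat_in_Mat_set:
  assumes "c \<in> pos_vecs n" "(\<Sum>i = 0..<n. c $ i) = real n" "1 \<le> n"
  shows "uniform_mat n c \<in> Mat_set n c"
proof -
  have c: "c \<in> carrier_vec n" "\<And>i. i < n \<Longrightarrow> 0 < c $ i" using assms by (auto simp: pos_vecs_def)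
  show ?thesis
    using c assms uniform_mat_carrier[OF c(1)]
    by (auto simp: Mat_set_def uniform_mat_entry sum_divide_distrib[symmetric] less_imp_le
        simp del: index_smult_mat)
qed

lemma permanent_uniform_mat:
  assumes "c \<in> carrier_vec n"
  shows "permanent (uniform_mat n c) = fact n / real n ^ n * (\<Prod>i = 0..<n. c $ i)"
proof -
  have "permanent (uniform_mat n c) = (\<Sum>p | p permutes {0..<n}. \<Prod>i = 0..<n. c $ p i / real n)"
    unfolding permanent_def using uniform_mat_carrier[OF assms]
    by (intro sum.cong prod.cong) (auto simp: uniform_mat_entry[OF assms] permutes_in_image simp del: index_smult_mat)
  also have "\<dots> = (\<Sum>p | p permutes {0..<n}. (\<Prod>i = 0..<n. c $ i) / real n ^ n)"
    using prod.permute[of _ "{0..<n}" "\<lambda>i. c $ i"]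
    by (intro sum.cong refl) (simp add: prod_dividef o_def)
  also have "\<dots> = fact n / real n ^ n * (\<Prod>i = 0..<n. c $ i)"
    by (simp add: card_permutations[of "{0..<n}" n])
  finally show ?thesis .
qed

text \<open>The product of all \<open>gurvits k\<close> up to \<open>n\<close> is
  \<open>fact n / n ^ n\<close>; the elimination that exploits the zero replaces one factor
  \<open>gurvits n\<close> by \<open>gurvits (n - 1)\<close>.\<close>

lemma permanent_zero_entry_bound:
  assumes n: "2 \<le> n" and c: "c \<in> pos_vecs n" and M: "M \<in> Mat_set n c"
    and z: "i0 < n" "j0 < n" "M $$ (i0, j0) = 0"
    and cap: "\<And>x. x \<in> pos_vecs n \<Longrightarrow> L * (\<Prod>i = 0..<n. x $ i) \<le> prod_poly M x"
  shows "L * (gurvits (n - 1) / gurvits n) * (fact n / real n ^ n) \<le> permanent M"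
proof -
  note MD = Mat_setD[OF M]
  \<comment> \<open>The elimination lemmas ask for non-negativity at all indices, so
    \<open>M\<close> is extended by zero.\<close>
  define m where "m i j = (if i < n \<and> j < n then M $$ (i, j) else 0)" for i j
  have "\<exists>i1<n. 0 < M $$ (i1, j0)"
  proof (rule ccontr)
    assume "\<not> (\<exists>i1<n. 0 < M $$ (i1, j0))"
    then have "(\<Sum>i = 0..<n. M $$ (i, j0)) \<le> 0" by (intro sum_nonpos) (use not_less in auto)
    then show False using MD(6)[OF z(2)] c z(2) by (auto simp: pos_vecs_def)
  qed
  then obtain i1 where i1: "i1 < n" "0 < M $$ (i1, j0)" by blast
  have "L * gurvits (n - 1) * (\<Prod>k=1..n - 1. gurvits k) \<le> lperm (map (\<lambda>j i. m i j) [0..<n]) {0..<n}"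
  proof (rule lperm_zero_entry_bound[where ?i0.0 = i0 and ?i1.0 = i1 and ?j0.0 = j0])
    fix x :: "nat \<Rightarrow> real" assume x: "\<And>j. 0 < x j"
    have "vec n x \<in> pos_vecs n" using x by (simp add: pos_vecs_def)
    from cap[OF this] show "L * (\<Prod>j<n. x j) \<le> (\<Prod>i = 0..<n. \<Sum>j<n. m i j * x j)"
      using MD(2,3) by (simp add: prod_poly_def m_def lessThan_atLeast0)
  qed (use n z i1 MD(4) in \<open>auto simp: m_def\<close>)
  also have "lperm (map (\<lambda>j i. m i j) [0..<n]) {0..<n} = permanent M"
    unfolding permanent_eq_lperm[OF MD(1)]
  proof -
    have "lperm (map (\<lambda>j i. m i j) js) S = lperm (map (\<lambda>j i. M $$ (i, j)) js) S"
      if "set js \<subseteq> {0..<n}" "S \<subseteq> {0..<n}" for js S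
      using that
    proof (induction js arbitrary: S)
      case (Cons j js)
      then have "lperm (map (\<lambda>j i. m i j) js) (S - {i}) = lperm (map (\<lambda>j i. M $$ (i, j)) js) (S - {i})" for i
        by (intro Cons.IH) auto
      then show ?case
        using Cons.prems by (auto simp: m_def intro!: sum.cong)
    qed simp
    then show "lperm (map (\<lambda>j i. m i j) [0..<n]) {0..<n} = lperm (map (\<lambda>j i. M $$ (i, j)) [0..<n]) {0..<n}"
      by simp
  qed
  also have "L * gurvits (n - 1) * (\<Prod>k=1..n - 1. gurvits k) = L * (gurvits (n - 1) / gurvits n) * (fact n / real n ^ n)"
  proof -
    have "(\<Prod>k=1..n. gurvits k) = (\<Prod>k=1..n - 1. gurvits k) * gurvits n"
      using n by (cases n) auto
    then have "(\<Prod>k=1..n - 1. gurvits k) = fact n / real n ^ n / gurvits n"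
      using prod_gurvits[of n] gurvits_pos[of n] n by (simp add: field_simps)
    then show ?thesis by simp
  qed
  finally show ?thesis .
qed

section \<open>Mixing two rows\<close>

definition mix_rows :: "nat \<Rightarrow> real mat \<Rightarrow> nat \<Rightarrow> nat \<Rightarrow> real \<Rightarrow> real mat" where
  "mix_rows n M i k t = mat n n (\<lambda>(l, j).
     if l = i then (1 - t) * M $$ (i, j) + t * M $$ (k, j)
     else if l = k then t * M $$ (i, j) + (1 - t) * M $$ (k, j)
     else M $$ (l, j))"

text \<open>The permanent is linear in each of the two rows, hence quadratic in \<open>t\<close>. It
  agrees at \<open>t = 0\<close> and \<open>t = 1\<close>, because \<open>t = 1\<close> interchanges
  the rows, so it differs from its value at \<open>0\<close> by a multiple of
  \<open>t * (1 - t)\<close>.\<close>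

lemma permanent_mix_rows:
  assumes M: "M \<in> carrier_mat n n" and ik: "i < n" "k < n" "i \<noteq> k"
  obtains \<beta> where "\<And>t. permanent (mix_rows n M i k t) = permanent M + \<beta> * (t * (1 - t))"
proof -
  let ?P = "{p. p permutes {0..<n}}"
  define R where "R p = (\<Prod>l\<in>{0..<n} - {i} - {k}. M $$ (l, p l))" for p
  let ?ad = "\<Sum>p\<in>?P. M $$ (i, p i) * M $$ (k, p k) * R p"
  let ?bc = "\<Sum>p\<in>?P. M $$ (k, p i) * M $$ (i, p k) * R p"
  let ?x = "\<Sum>p\<in>?P. (M $$ (i, p i) * M $$ (i, p k) + M $$ (k, p i) * M $$ (k, p k)) * R p"
  have split: "(\<Prod>l = 0..<n. f l) = f i * (f k * (\<Prod>l\<in>{0..<n} - {i} - {k}. f l))" for f :: "nat \<Rightarrow> real"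
    using ik by (simp add: prod.remove[of "{0..<n}" i] prod.remove[of "{0..<n} - {i}" k])
  have per: "permanent (mix_rows n M i k t) = (1 - t)\<^sup>2 * ?ad + t\<^sup>2 * ?bc + t * (1 - t) * ?x" for t
  proof -
    have "permanent (mix_rows n M i k t) = (\<Sum>p\<in>?P. (1 - t)\<^sup>2 * (M $$ (i, p i) * M $$ (k, p k) * R p)
       + t\<^sup>2 * (M $$ (k, p i) * M $$ (i, p k) * R p)
       + t * (1 - t) * ((M $$ (i, p i) * M $$ (i, p k) + M $$ (k, p i) * M $$ (k, p k)) * R p))"
      unfolding permanent_def
    proof (rule sum.cong)
      fix p assume "p \<in> ?P"
      then have p: "p l < n" if "l < n" for l using that permutes_in_image[of p "{0..<n}" l] by simp
      have R: "(\<Prod>l\<in>{0..<n} - {i} - {k}. mix_rows n M i k t $$ (l, p l)) = R p"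
        unfolding R_def by (intro prod.cong refl) (auto simp: mix_rows_def p)
      have "(\<Prod>l = 0..<dim_row (mix_rows n M i k t). mix_rows n M i k t $$ (l, p l))
        = ((1 - t) * M $$ (i, p i) + t * M $$ (k, p i)) * ((t * M $$ (i, p k) + (1 - t) * M $$ (k, p k)) * R p)"
        using ik p R split[of "\<lambda>l. mix_rows n M i k t $$ (l, p l)"] by (simp add: mix_rows_def)
      then show "(\<Prod>l = 0..<dim_row (mix_rows n M i k t). mix_rows n M i k t $$ (l, p l)) =
         (1 - t)\<^sup>2 * (M $$ (i, p i) * M $$ (k, p k) * R p)
       + t\<^sup>2 * (M $$ (k, p i) * M $$ (i, p k) * R p)
       + t * (1 - t) * ((M $$ (i, p i) * M $$ (i, p k) + M $$ (k, p i) * M $$ (k, p k)) * R p)"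
        by (simp add: power2_eq_square algebra_simps)
    qed (simp add: mix_rows_def)
    then show ?thesis by (simp only: sum.distrib sum_distrib_left)
  qed
  \<comment> \<open>These are the values at \<open>t = 0\<close> and \<open>t = 1\<close>; composing
    permutations with the transposition of \<open>i\<close> and \<open>k\<close> exchanges
    them.\<close>
  have "?ad = ?bc"
  proof -
    let ?\<tau> = "Transposition.transpose i k"
    have \<tau>: "?\<tau> permutes {0..<n}" using ik by (intro permutes_swap_id) auto
    have "?ad = (\<Sum>p\<in>?P. M $$ (i, (p \<circ> ?\<tau>) i) * M $$ (k, (p \<circ> ?\<tau>) k) * R (p \<circ> ?\<tau>))"
      by (rule sum_permutations_compose_right[OF \<tau>])
    also have "\<dots> = ?bc"
    proof (rule sum.cong[OF refl])
      fix p
      have "R (p \<circ> ?\<tau>) = R p" unfolding R_def by (intro prod.cong refl) (auto simp: transpose_def)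
      then show "M $$ (i, (p \<circ> ?\<tau>) i) * M $$ (k, (p \<circ> ?\<tau>) k) * R (p \<circ> ?\<tau>) = M $$ (k, p i) * M $$ (i, p k) * R p"
        by simp
    qed
    finally show ?thesis .
  qed
  moreover have "mix_rows n M i k 0 = M"
    using M by (intro eq_matI) (auto simp: mix_rows_def)
  then have "permanent M = ?ad" using per[of 0] by simp
  ultimately have "permanent (mix_rows n M i k t) = permanent M + (?x - 2 * permanent M) * (t * (1 - t))" for t
    unfolding per by (simp add: power2_eq_square algebra_simps)
  then show thesis by (rule that)
qed

text \<open>Mixing preserves row and column sums for every real \<open>t\<close>, so the signs alone
  decide membership; \<open>t\<close> may leave the unit interval.\<close>

lemma mix_rows_in_Mat_set:
  assumes M: "M \<in> Mat_set n c" and ik: "i < n" "k < n" "i \<noteq> k"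
    and nn: "\<And>j. j < n \<Longrightarrow> 0 \<le> (1 - t) * M $$ (i, j) + t * M $$ (k, j)"
      "\<And>j. j < n \<Longrightarrow> 0 \<le> t * M $$ (i, j) + (1 - t) * M $$ (k, j)"
  shows "mix_rows n M i k t \<in> Mat_set n c"
proof -
  note MD = Mat_setD[OF M]
  have "(\<Sum>j = 0..<n. mix_rows n M i k t $$ (l, j)) = 1" if l: "l < n" for l
  proof -
    have "(\<Sum>j = 0..<n. mix_rows n M i k t $$ (l, j)) = (if l = i then (1 - t) * (\<Sum>j = 0..<n. M $$ (i, j)) + t * (\<Sum>j = 0..<n. M $$ (k, j))
       else if l = k then t * (\<Sum>j = 0..<n. M $$ (i, j)) + (1 - t) * (\<Sum>j = 0..<n. M $$ (k, j)) else (\<Sum>j = 0..<n. M $$ (l, j)))"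
      using l by (simp add: mix_rows_def sum.distrib sum_distrib_left)
    then show ?thesis using MD(5) ik l by simp
  qed
  moreover have "(\<Sum>l = 0..<n. mix_rows n M i k t $$ (l, j)) = c $ j" if j: "j < n" for j
  proof -
    have split: "(\<Sum>l = 0..<n. f l) = f i + (f k + (\<Sum>l\<in>{0..<n} - {i} - {k}. f l))" for f :: "nat \<Rightarrow> real"
      using ik by (simp add: sum.remove[of "{0..<n}" i] sum.remove[of "{0..<n} - {i}" k])
    have "(\<Sum>l\<in>{0..<n} - {i} - {k}. mix_rows n M i k t $$ (l, j)) = (\<Sum>l\<in>{0..<n} - {i} - {k}. M $$ (l, j))"
      using j by (intro sum.cong refl) (auto simp: mix_rows_def)
    then have "(\<Sum>l = 0..<n. mix_rows n M i k t $$ (l, j)) = (\<Sum>l = 0..<n. M $$ (l, j))"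
      unfolding split using ik j by (simp add: mix_rows_def algebra_simps)
    then show ?thesis using MD(6)[OF j] by simp
  qed
  ultimately show ?thesis
    using nn MD(4) by (auto simp: Mat_set_def mix_rows_def)
qed

text \<open>The minimum ratio test: \<open>t\<close> is the least zero among the decreasing
  functions of the family.\<close>

lemma first_zero_of_affine_family:
  fixes \<alpha> \<beta> :: "'i \<Rightarrow> real"
  assumes "finite I" "\<And>s. s \<in> I \<Longrightarrow> 0 < \<alpha> s" "s0 \<in> I" "\<beta> s0 < 0"
  obtains t s where "0 < t" "\<And>s. s \<in> I \<Longrightarrow> 0 \<le> \<alpha> s + t * \<beta> s" "s \<in> I" "\<alpha> s + t * \<beta> s = 0"
proof -
  define J where "J = {s \<in> I. \<beta> s < 0}"
  have J: "finite J" "J \<noteq> {}" using assms by (auto simp: J_def)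
  obtain s where s: "s \<in> J" and min: "\<And>r. r \<in> J \<Longrightarrow> \<alpha> s / - \<beta> s \<le> \<alpha> r / - \<beta> r"
    using arg_min_if_finite(1)[OF J, of "\<lambda>s. \<alpha> s / - \<beta> s"] arg_min_least[OF J, of _ "\<lambda>s. \<alpha> s / - \<beta> s"] by blast
  define t where "t = \<alpha> s / - \<beta> s"
  have s': "0 < \<alpha> s" "\<beta> s < 0" using s assms by (auto simp: J_def)
  then have t: "0 < t" by (simp add: t_def divide_pos_neg)
  show thesis
  proof
    fix r assume r: "r \<in> I"
    show "0 \<le> \<alpha> r + t * \<beta> r"
    proof (cases "\<beta> r < 0")
      case True
      then have "t \<le> \<alpha> r / - \<beta> r" using min[of r] r by (simp add: J_def t_def)
      then show ?thesis using True by (simp add: field_simps)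
    next
      case False
      then show ?thesis using t assms(2)[OF r] by (intro add_nonneg_nonneg mult_nonneg_nonneg) auto
    qed
  next
    show "\<alpha> s + t * \<beta> s = 0" using s' by (simp add: t_def)
  qed (use s t J_def in auto)
qed

text \<open>Along the segment mixing two rows the permanent is a quadratic polynomial in \<open>t\<close>, symmetric about
  \<open>t = 1/2\<close> and minimal at \<open>t = 0\<close>; hence it cannot increase beyond \<open>t = 1\<close>, where an entry eventually
  vanishes.\<close>

lemma interior_minimizer_equal_rows:
  assumes M: "M \<in> Mat_set n c" and pos: "\<And>i j. i < n \<Longrightarrow> j < n \<Longrightarrow> 0 < M $$ (i, j)"
    and min: "\<And>N. N \<in> Mat_set n c \<Longrightarrow> permanent M \<le> permanent N"
    and bd: "\<And>N i j. N \<in> Mat_set n c \<Longrightarrow> i < n \<Longrightarrow> j < n \<Longrightarrow> N $$ (i, j) = 0 \<Longrightarrow> permanent M < permanent N"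
    and ik: "i < n" "k < n" and j: "j < n"
  shows "M $$ (i, j) = M $$ (k, j)"
proof (rule ccontr)
  assume neq: "M $$ (i, j) \<noteq> M $$ (k, j)"
  then have ne: "i \<noteq> k" by auto
  note MD = Mat_setD[OF M]
  \<comment> \<open>The entries of the two mixed rows as affine functions of \<open>t\<close>; the
    truth value selects row \<open>i\<close> or row \<open>k\<close>.\<close>
  define \<alpha> where "\<alpha> = (\<lambda>(b, j). if b then M $$ (i, j) else M $$ (k, j))"
  define \<beta> where "\<beta> = (\<lambda>(b, j). if b then M $$ (k, j) - M $$ (i, j) else M $$ (i, j) - M $$ (k, j))"
  obtain t s where t: "0 < t" and nn: "\<And>s. s \<in> UNIV \<times> {0..<n} \<Longrightarrow> 0 \<le> \<alpha> s + t * \<beta> s"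
    and s: "s \<in> (UNIV :: bool set) \<times> {0..<n}" "\<alpha> s + t * \<beta> s = 0"
  \<comment> \<open>The comparison in the index selects whichever of the two differing entries
    decreases with \<open>t\<close>.\<close>
  proof (rule first_zero_of_affine_family[of "UNIV \<times> {0..<n}" \<alpha> "(M $$ (k, j) < M $$ (i, j), j)" \<beta>])
    show "0 < \<alpha> s" if "s \<in> UNIV \<times> {0..<n}" for s
      using that pos ik by (auto simp: \<alpha>_def)
  qed (use neq j in \<open>auto simp: \<beta>_def\<close>)
  \<comment> \<open>For \<open>0 < t < 1\<close> the mixed entries are proper convex combinations of
    positive entries, so none vanishes.\<close>
  have t1: "1 \<le> t"
  proof (rule ccontr)
    assume "\<not> 1 \<le> t"
    moreover obtain b l where bl: "s = (b, l)" "l < n" using s(1) by auto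
    ultimately have "0 < (1 - t) * M $$ (i, l) + t * M $$ (k, l)" "0 < (1 - t) * M $$ (k, l) + t * M $$ (i, l)"
      using t pos ik by (auto intro!: add_pos_pos)
    then show False using s(2) bl by (auto simp: \<alpha>_def \<beta>_def algebra_simps split: if_splits)
  qed
  obtain \<gamma> where per: "\<And>t. permanent (mix_rows n M i k t) = permanent M + \<gamma> * (t * (1 - t))"
    using permanent_mix_rows[OF MD(1) ik ne] by blast
  \<comment> \<open>Minimality of \<open>M\<close> against the midpoint fixes the sign of
    \<open>\<gamma>\<close>.\<close>
  have "mix_rows n M i k (1/2) \<in> Mat_set n c"
    using MD(4) ik by (intro mix_rows_in_Mat_set[OF M ik ne]) auto
  then have \<gamma>: "0 \<le> \<gamma>" using min per[of "1/2"] by fastforce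
  have N: "mix_rows n M i k t \<in> Mat_set n c"
  proof (rule mix_rows_in_Mat_set[OF M ik ne])
    fix l assume "l < n"
    then show "0 \<le> (1 - t) * M $$ (i, l) + t * M $$ (k, l)" "0 \<le> t * M $$ (i, l) + (1 - t) * M $$ (k, l)"
      using nn[of "(True, l)"] nn[of "(False, l)"] by (simp_all add: \<alpha>_def \<beta>_def algebra_simps)
  qed
  obtain b l where bl: "s = (b, l)" "l < n" using s(1) by auto
  have "mix_rows n M i k t $$ (if b then i else k, l) = 0"
    using s(2) bl ik ne by (cases b) (auto simp: mix_rows_def \<alpha>_def \<beta>_def algebra_simps)
  then have "permanent M < permanent (mix_rows n M i k t)"
    using bd[OF N _ bl(2)] ik by (cases b) auto
  moreover have "\<gamma> * (t * (1 - t)) \<le> 0"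
    using \<gamma> t t1 by (intro mult_nonneg_nonpos mult_nonneg_nonpos) auto
  ultimately show False using per[of t] by simp
qed

section \<open>Compactness and uniqueness of the minimizer\<close>

text \<open>Bolzano-Weierstrass one index at a time: a bounded monotone subsequence converges, and
  earlier limits survive the refinement.\<close>

lemma finite_family_convergent_subsequence:
  fixes f :: "nat \<Rightarrow> 'i \<Rightarrow> real"
  assumes "finite I" "\<And>k s. s \<in> I \<Longrightarrow> \<bar>f k s\<bar> \<le> B"
  obtains r l where "strict_mono (r :: nat \<Rightarrow> nat)" "\<And>s. s \<in> I \<Longrightarrow> (\<lambda>k. f (r k) s) \<longlonglongrightarrow> l s"
proof -
  have "\<exists>r l. strict_mono (r :: nat \<Rightarrow> nat) \<and> (\<forall>s\<in>I. (\<lambda>k. f (r k) s) \<longlonglongrightarrow> l s)"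
    using assms
  proof (induction I rule: finite_induct)
    case empty
    show ?case by (intro exI[of _ id]) (simp add: strict_mono_def)
  next
    case (insert a I)
    then have "\<exists>r l. strict_mono (r :: nat \<Rightarrow> nat) \<and> (\<forall>s\<in>I. (\<lambda>k. f (r k) s) \<longlonglongrightarrow> l s)"
      by simp
    then obtain r l where r: "strict_mono (r :: nat \<Rightarrow> nat)" and l: "\<And>s. s \<in> I \<Longrightarrow> (\<lambda>k. f (r k) s) \<longlonglongrightarrow> l s"
      by blast
    obtain q where q: "strict_mono (q :: nat \<Rightarrow> nat)" "monoseq (\<lambda>k. f (r (q k)) a)"
      using seq_monosub[of "\<lambda>k. f (r k) a"] by auto
    have "Bseq (\<lambda>k. f (r (q k)) a)"
      using insert.prems by (intro BseqI'[where K = B]) simp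
    then obtain la where la: "(\<lambda>k. f (r (q k)) a) \<longlonglongrightarrow> la"
      using Bseq_monoseq_convergent[OF _ q(2)] by (auto simp: convergent_def)
    have "(\<lambda>k. f ((r \<circ> q) k) s) \<longlonglongrightarrow> (l(a := la)) s" if "s \<in> insert a I" for s
      using that la l[of s] LIMSEQ_subseq_LIMSEQ[OF _ q(1), of "\<lambda>k. f (r k) s"]
      by (auto simp: o_def)
    then show ?case
      using strict_mono_o[OF r q(1)] by blast
  qed
  then show thesis using that by blast
qed

text \<open>Entries lie in the unit interval, and signs and sums pass to the limit. The column sums
  may vary with \<open>k\<close>: a constant sequence serves the existence of minimizers, one
  tending to \<open>ones_vec n\<close> the capacity bound.\<close>

lemma Mat_set_convergent_subsequence:
  assumes M: "\<And>k. M k \<in> Mat_set n (c k)" and c: "\<And>j. j < n \<Longrightarrow> (\<lambda>k. c k $ j) \<longlonglongrightarrow> c' $ j"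
  obtains r D where "strict_mono (r :: nat \<Rightarrow> nat)" "D \<in> Mat_set n c'"
    "\<And>i j. i < n \<Longrightarrow> j < n \<Longrightarrow> (\<lambda>k. M (r k) $$ (i, j)) \<longlonglongrightarrow> D $$ (i, j)"
proof -
  have fin: "finite ({0..<n} \<times> {0..<n})" by simp
  have bd: "\<bar>M k $$ s\<bar> \<le> 1" if "s \<in> {0..<n} \<times> {0..<n}" for k s
    using that Mat_setD(4)[OF M[of k]] Mat_set_entry_le_1[OF M[of k]] by auto
  obtain r l where r: "strict_mono (r :: nat \<Rightarrow> nat)"
    and l': "\<And>s. s \<in> {0..<n} \<times> {0..<n} \<Longrightarrow> (\<lambda>k. M (r k) $$ s) \<longlonglongrightarrow> l s"
    using finite_family_convergent_subsequence[OF fin, of "\<lambda>k s. M k $$ s" 1] bd by blast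
  have l: "(\<lambda>k. M (r k) $$ (i, j)) \<longlonglongrightarrow> l (i, j)" if "i < n" "j < n" for i j
    using l' that by simp
  have "mat n n l \<in> Mat_set n c'"
    unfolding Mat_set_def
  proof (intro CollectI conjI allI impI)
    show "0 \<le> mat n n l $$ (i, j)" if "i < n" "j < n" for i j
      using LIMSEQ_le_const[OF l[OF that], of 0] Mat_setD(4)[OF M] that by auto
    show "(\<Sum>j = 0..<n. mat n n l $$ (i, j)) = 1" if i: "i < n" for i
    proof -
      have "(\<lambda>k. \<Sum>j = 0..<n. M (r k) $$ (i, j)) \<longlonglongrightarrow> (\<Sum>j = 0..<n. l (i, j))"
        using l i by (intro tendsto_sum) auto
      then have "(\<lambda>k. 1) \<longlonglongrightarrow> (\<Sum>j = 0..<n. l (i, j))" using Mat_setD(5)[OF M i] by simp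
      then show ?thesis using i by (simp add: LIMSEQ_const_iff)
    qed
    show "(\<Sum>i = 0..<n. mat n n l $$ (i, j)) = c' $ j" if j: "j < n" for j
    proof -
      have "(\<lambda>k. \<Sum>i = 0..<n. M (r k) $$ (i, j)) \<longlonglongrightarrow> (\<Sum>i = 0..<n. l (i, j))"
        using l j by (intro tendsto_sum) auto
      moreover have "(\<lambda>k. c (r k) $ j) \<longlonglongrightarrow> c' $ j"
        using LIMSEQ_subseq_LIMSEQ[OF c[OF j] r] by (simp add: o_def)
      ultimately show ?thesis
        using Mat_setD(6)[OF M j] j LIMSEQ_unique by fastforce
    qed
  qed simp
  then show thesis using that[OF r] l by simp
qed

text \<open>A minimizing sequence has a convergent subsequence, and the permanent is continuous in
  the entries.\<close>

lemma permanent_minimizer_exists: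
  assumes "Mat_set n c \<noteq> {}"
  obtains M where "M \<in> Mat_set n c" "\<And>N. N \<in> Mat_set n c \<Longrightarrow> permanent M \<le> permanent N"
proof -
  define v where "v = Inf (permanent ` Mat_set n c)"
  have nonneg: "0 \<le> permanent N" if "N \<in> Mat_set n c" for N
    unfolding permanent_def using Mat_setD(2,4)[OF that]
    by (intro sum_nonneg prod_nonneg) (auto simp: permutes_in_image)
  have bdd: "bdd_below (permanent ` Mat_set n c)"
    using nonneg by (intro bdd_belowI[of _ 0]) auto
  have low: "v \<le> permanent N" if "N \<in> Mat_set n c" for N
    unfolding v_def using bdd that by (intro cInf_lower) auto
  have "\<exists>N\<in>Mat_set n c. permanent N < v + 1 / real (Suc k)" for k
  proof -
    have "v < v + 1 / real (Suc k)" by simp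
    then show ?thesis
      using assms unfolding v_def by (subst (asm) cInf_less_iff) (use bdd in auto)
  qed
  then obtain M where M: "\<And>k. M k \<in> Mat_set n c" "\<And>k. permanent (M k) < v + 1 / real (Suc k)"
    by metis
  obtain r D where r: "strict_mono (r :: nat \<Rightarrow> nat)" and D: "D \<in> Mat_set n c"
    and lim: "\<And>i j. i < n \<Longrightarrow> j < n \<Longrightarrow> (\<lambda>k. M (r k) $$ (i, j)) \<longlonglongrightarrow> D $$ (i, j)"
    using Mat_set_convergent_subsequence[of M n "\<lambda>_. c" c] M(1) by auto
  have "(\<lambda>k. permanent (M (r k))) \<longlonglongrightarrow> permanent D"
    unfolding permanent_def Mat_setD(2)[OF M(1)] Mat_setD(2)[OF D]
    using lim by (intro tendsto_sum tendsto_prod) (auto simp: permutes_in_image)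
  moreover have "(\<lambda>k. v + 1 / real (Suc (r k))) \<longlonglongrightarrow> v + 0"
    using LIMSEQ_subseq_LIMSEQ[OF LIMSEQ_Suc[OF lim_1_over_n] r]
    by (intro tendsto_add tendsto_const) (simp add: o_def)
  ultimately have "permanent D \<le> v + 0"
    using M(2) by (intro LIMSEQ_le[where X = "\<lambda>k. permanent (M (r k))"]) (auto intro: less_imp_le)
  then have "permanent D \<le> permanent N" if "N \<in> Mat_set n c" for N
    using low[OF that] by simp
  with D show thesis by (rule that)
qed

text \<open>Any minimizer is positive with equal rows, which identifies it. That the uniform matrix
  is itself a minimizer then follows because some minimizer exists.\<close>

lemma unique_minimizer_from_capacity:
  assumes n: "2 \<le> n" and c: "c \<in> pos_vecs n" and sum: "(\<Sum>i = 0..<n. c $ i) = real n" and L: "0 < L"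
    and cap: "\<And>M x. M \<in> Mat_set n c \<Longrightarrow> x \<in> pos_vecs n \<Longrightarrow> L * (\<Prod>i = 0..<n. x $ i) \<le> prod_poly M x"
    and less: "(\<Prod>i = 0..<n. c $ i) / L < gurvits (n - 1) / gurvits n"
  shows "unique_minimizer permanent (Mat_set n c) (uniform_mat n c)"
proof -
  have cc: "c \<in> carrier_vec n" using c by (simp add: pos_vecs_def)
  have U: "uniform_mat n c \<in> Mat_set n c"
    using uniform_mat_in_Mat_set[OF c sum] n by simp
  have bd: "permanent (uniform_mat n c) < permanent N"
    if N: "N \<in> Mat_set n c" "i < n" "j < n" "N $$ (i, j) = 0" for N i j
  proof -
    have "0 < fact n / real n ^ n" using n by simp
    moreover have "(\<Prod>i = 0..<n. c $ i) < L * (gurvits (n - 1) / gurvits n)"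
      using less L by (simp only: pos_divide_less_eq mult.commute)
    ultimately have "permanent (uniform_mat n c) < L * (gurvits (n - 1) / gurvits n) * (fact n / real n ^ n)"
      unfolding permanent_uniform_mat[OF cc] by (subst mult.commute) (rule mult_strict_right_mono)
    also have "\<dots> \<le> permanent N"
      using permanent_zero_entry_bound[OF n c N] cap[OF N(1)] by blast
    finally show ?thesis .
  qed
  have eq: "M = uniform_mat n c"
    if M: "M \<in> Mat_set n c" and min: "\<And>N. N \<in> Mat_set n c \<Longrightarrow> permanent M \<le> permanent N" for M
  proof -
    have bd': "permanent M < permanent N" if "N \<in> Mat_set n c" "i < n" "j < n" "N $$ (i, j) = 0" for N i j
      using bd[OF that] min[OF U] by simp
    have pos: "0 < M $$ (i, j)" if "i < n" "j < n" for i j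
      using bd'[OF M that] Mat_setD(4)[OF M that] by fastforce
    have rows: "M $$ (i, j) = M $$ (k, j)" if "i < n" "k < n" "j < n" for i j k
      by (rule interior_minimizer_equal_rows[OF M pos min _ that]) (assumption+, rule bd')
    show ?thesis
    proof (rule eq_matI)
      fix i j assume "i < dim_row (uniform_mat n c)" "j < dim_col (uniform_mat n c)"
      then have ij: "i < n" "j < n" using uniform_mat_carrier[OF cc] by auto
      \<comment> \<open>With equal rows a column sum is \<open>n\<close> times any entry of the
        column.\<close>
      have "c $ j = (\<Sum>k = 0..<n. M $$ (i, j))"
        unfolding Mat_setD(6)[OF M ij(2), symmetric] by (intro sum.cong refl rows) (use ij in auto)
      then show "M $$ (i, j) = uniform_mat n c $$ (i, j)"
        using n by (simp add: uniform_mat_entry[OF cc ij] del: index_smult_mat)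
    qed (use Mat_setD(2,3)[OF M] uniform_mat_carrier[OF cc] in auto)
  qed
  obtain M where M: "M \<in> Mat_set n c" and min: "\<And>N. N \<in> Mat_set n c \<Longrightarrow> permanent M \<le> permanent N"
    using permanent_minimizer_exists U by (metis empty_iff)
  have "is_arg_min permanent (\<lambda>y. y \<in> Mat_set n c) x \<longleftrightarrow> x = uniform_mat n c" for x
  proof
    assume "is_arg_min permanent (\<lambda>y. y \<in> Mat_set n c) x"
    then show "x = uniform_mat n c" by (intro eq) (auto simp: is_arg_min_def not_less)
  next
    assume "x = uniform_mat n c"
    then have "x = M" using eq[OF M min] by simp
    then show "is_arg_min permanent (\<lambda>y. y \<in> Mat_set n c) x"
      using M min by (auto simp: is_arg_min_def not_less)
  qed
  then show ?thesis by (simp add: unique_minimizer_def)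
qed

section \<open>Capacity near the all-ones vector\<close>

lemma doubly_stochastic_capacity:
  assumes D: "D \<in> Mat_set n (ones_vec n)" and x: "x \<in> pos_vecs n"
  shows "(\<Prod>i = 0..<n. x $ i) \<le> prod_poly D x"
proof (cases "n = 0")
  case True
  then show ?thesis using Mat_setD(2)[OF D] by (simp add: prod_poly_def)
next
  case False
  note DD = Mat_setD[OF D]
  have xp: "0 < x $ j" if "j < n" for j using x that by (simp add: pos_vecs_def)
  define s where "s i = (\<Sum>j = 0..<n. D $$ (i, j) * x $ j)" for i
  have s: "0 < s i" if i: "i < n" for i
  proof -
    have "0 \<le> s i" unfolding s_def using DD(4)[OF i] xp by (intro sum_nonneg mult_nonneg_nonneg) (auto intro: less_imp_le)
    moreover have "s i \<noteq> 0"
    proof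
      assume "s i = 0"
      then have "\<forall>j\<in>{0..<n}. D $$ (i, j) * x $ j = 0"
        unfolding s_def using DD(4)[OF i] xp
        by (subst (asm) sum_nonneg_eq_0_iff) (auto intro!: mult_nonneg_nonneg intro: less_imp_le)
      then have "(\<Sum>j = 0..<n. D $$ (i, j)) = 0" using xp by (intro sum.neutral) fastforce
      then show False using DD(5)[OF i] by simp
    qed
    ultimately show ?thesis by simp
  qed
  \<comment> \<open>Concavity of the logarithm with the entries of row \<open>i\<close> as weights;
    on adding the rows, the unit column sums collect the left-hand sides into the sum of all
    \<open>ln (x $ j)\<close>.\<close>
  have jensen: "(\<Sum>j = 0..<n. D $$ (i, j) * ln (x $ j)) \<le> ln (s i)" if i: "i < n" for i
    using concave_on_sum[OF _ _ ln_concave DD(5)[OF i], of "\<lambda>j. x $ j"] DD(4)[OF i] xp False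
    by (simp add: s_def)
  have "(\<Sum>j = 0..<n. ln (x $ j)) = (\<Sum>j = 0..<n. (\<Sum>i = 0..<n. D $$ (i, j)) * ln (x $ j))"
    using DD(6) by (intro sum.cong refl) (simp add: ones_vec_def)
  also have "\<dots> = (\<Sum>i = 0..<n. \<Sum>j = 0..<n. D $$ (i, j) * ln (x $ j))"
    unfolding sum_distrib_right by (rule sum.swap)
  also have "\<dots> \<le> (\<Sum>i = 0..<n. ln (s i))"
    using jensen by (intro sum_mono) auto
  finally have "exp (\<Sum>j = 0..<n. ln (x $ j)) \<le> exp (\<Sum>i = 0..<n. ln (s i))" by simp
  then have "(\<Prod>i = 0..<n. x $ i) \<le> (\<Prod>i = 0..<n. s i)"
    using xp s by (simp add: exp_sum)
  then show ?thesis using DD(2,3) by (simp add: prod_poly_def s_def)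
qed

text \<open>A limit of matrices with column sums tending to \<open>1\<close> is doubly stochastic, and on its support it is
  eventually dominated by them up to a factor \<open>1 - \<delta>\<close>.\<close>

lemma capacity_lower_bound_near_ones:
  assumes \<delta>: "0 < \<delta>" "\<delta> < 1"
  obtains \<epsilon> where "0 < \<epsilon>"
    "\<And>c M x. c \<in> carrier_vec n \<Longrightarrow> l1_norm (c - ones_vec n) < \<epsilon> \<Longrightarrow> M \<in> Mat_set n c \<Longrightarrow> x \<in> pos_vecs n
      \<Longrightarrow> (1 - \<delta>) ^ n * (\<Prod>i = 0..<n. x $ i) \<le> prod_poly M x"
proof -
  have "\<exists>\<epsilon>>0. \<forall>c M x. c \<in> carrier_vec n \<and> l1_norm (c - ones_vec n) < \<epsilon> \<and> M \<in> Mat_set n c \<and> x \<in> pos_vecs n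
      \<longrightarrow> (1 - \<delta>) ^ n * (\<Prod>i = 0..<n. x $ i) \<le> prod_poly M x" (is "\<exists>\<epsilon>>0. ?P \<epsilon>")
  proof (rule ccontr)
    assume no: "\<not> (\<exists>\<epsilon>>0. ?P \<epsilon>)"
    \<comment> \<open>Failure at every radius yields sequences of counterexamples with
      \<open>c k\<close> tending to \<open>ones_vec n\<close>.\<close>
    have "\<not> ?P (1 / real (Suc k))" for k
    proof
      assume "?P (1 / real (Suc k))"
      moreover have "0 < 1 / real (Suc k)" by simp
      ultimately show False using no by blast
    qed
    then have "\<exists>c M x. c \<in> carrier_vec n \<and> l1_norm (c - ones_vec n) < 1 / real (Suc k) \<and> M \<in> Mat_set n c
        \<and> x \<in> pos_vecs n \<and> \<not> (1 - \<delta>) ^ n * (\<Prod>i = 0..<n. x $ i) \<le> prod_poly M x" for k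
      by (simp only: not_all not_imp conj_assoc)
    then obtain c M x where cMx: "\<And>k. c k \<in> carrier_vec n" "\<And>k. l1_norm (c k - ones_vec n) < 1 / real (Suc k)"
      "\<And>k. M k \<in> Mat_set n (c k)" "\<And>k. x k \<in> pos_vecs n"
      "\<And>k. \<not> (1 - \<delta>) ^ n * (\<Prod>i = 0..<n. x k $ i) \<le> prod_poly (M k) (x k)"
      by metis
    have conv: "(\<lambda>k. c k $ j) \<longlonglongrightarrow> ones_vec n $ j" if j: "j < n" for j
    proof -
      have bd: "\<bar>c k $ j - 1\<bar> \<le> 1 / real (Suc k)" for k
      proof -
        have "\<bar>(c k - ones_vec n) $ j\<bar> \<le> l1_norm (c k - ones_vec n)"
          unfolding l1_norm_def using cMx(1)[of k] j
          by (intro member_le_sum) (auto simp: ones_vec_def)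
        then show ?thesis using cMx(2)[of k] j cMx(1)[of k] by (simp add: ones_vec_def)
      qed
      have "(\<lambda>k. c k $ j - 1) \<longlonglongrightarrow> 0"
        by (rule tendsto_rabs_zero_cancel[OF tendsto_sandwich[OF _ _ tendsto_const LIMSEQ_Suc[OF lim_1_over_n]]])
           (use bd in auto)
      then show ?thesis using j by (simp add: LIM_zero_iff ones_vec_def)
    qed
    obtain r D where r: "strict_mono (r :: nat \<Rightarrow> nat)" and D: "D \<in> Mat_set n (ones_vec n)"
      and lim: "\<And>i j. i < n \<Longrightarrow> j < n \<Longrightarrow> (\<lambda>k. M (r k) $$ (i, j)) \<longlonglongrightarrow> D $$ (i, j)"
      by (rule Mat_set_convergent_subsequence[OF cMx(3) conv]) (assumption, rule that)
    have "\<forall>\<^sub>F k in sequentially. (1 - \<delta>) * D $$ (i, j) \<le> M (r k) $$ (i, j)" if ij: "i < n" "j < n" for i j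
    proof (cases "D $$ (i, j) = 0")
      case True
      then show ?thesis using Mat_setD(4)[OF cMx(3) ij] by simp
    next
      case False
      then have "(1 - \<delta>) * D $$ (i, j) < D $$ (i, j)"
        using Mat_setD(4)[OF D ij] \<delta> by (simp add: algebra_simps)
      from order_tendstoD(1)[OF lim[OF ij] this] show ?thesis
        by eventually_elim simp
    qed
    then have "\<forall>\<^sub>F k in sequentially. \<forall>s\<in>{0..<n} \<times> {0..<n}. (1 - \<delta>) * D $$ s \<le> M (r k) $$ s"
      by (intro eventually_ball_finite) auto
    then obtain k where "\<forall>s\<in>{0..<n} \<times> {0..<n}. (1 - \<delta>) * D $$ s \<le> M (r k) $$ s"
      by (auto simp only: eventually_sequentially)
    then have k: "\<And>i j. i < n \<Longrightarrow> j < n \<Longrightarrow> (1 - \<delta>) * D $$ (i, j) \<le> M (r k) $$ (i, j)"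
      by simp
    \<comment> \<open>Entrywise domination gives the bound at every positive point at once, so the
      points \<open>x k\<close> may be unbounded.\<close>
    let ?x = "x (r k)"
    have xp: "0 \<le> ?x $ j" if "j < n" for j
      using cMx(4)[of "r k"] that by (auto simp: pos_vecs_def intro: less_imp_le)
    have "(1 - \<delta>) ^ n * (\<Prod>i = 0..<n. ?x $ i) \<le> (1 - \<delta>) ^ n * prod_poly D ?x"
      using doubly_stochastic_capacity[OF D cMx(4)] \<delta> by (intro mult_left_mono) auto
    also have "\<dots> = (\<Prod>i = 0..<n. \<Sum>j = 0..<n. (1 - \<delta>) * D $$ (i, j) * ?x $ j)"
      using Mat_setD(2,3)[OF D] by (simp add: prod_poly_def prod.distrib sum_distrib_left[symmetric] mult.assoc)
    also have "\<dots> \<le> (\<Prod>i = 0..<n. \<Sum>j = 0..<n. M (r k) $$ (i, j) * ?x $ j)"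
      using k xp Mat_setD(4)[OF D] \<delta>
      by (intro prod_mono conjI sum_mono sum_nonneg mult_right_mono mult_nonneg_nonneg) auto
    also have "\<dots> = prod_poly (M (r k)) ?x"
      using Mat_setD(2,3)[OF cMx(3)[of "r k"]] by (simp add: prod_poly_def)
    finally show False using cMx(5)[of "r k"] by simp
  qed
  then show thesis using that by blast
qed

lemma unique_minimizer_singleton: "unique_minimizer f {a} a"
  by (auto simp: unique_minimizer_def is_arg_min_def)

text \<open>For \<open>n = 1\<close> the set is a singleton and any radius works. Otherwise AM-GM
  bounds the product of \<open>c\<close> by 1, so a capacity bound \<open>L\<close> with
  \<open>1 / L < K\<close> suffices, where \<open>K > 1\<close> because \<open>gurvits\<close>
  decreases strictly.\<close>

lemma unique_minimizer_near_ones: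
  assumes n: "1 \<le> n"
  obtains \<epsilon> where "0 < \<epsilon>"
    "\<And>c. c \<in> pos_vecs n \<Longrightarrow> (\<Sum>i = 0..<n. c $ i) = real n \<Longrightarrow> l1_norm (c - ones_vec n) < \<epsilon>
      \<Longrightarrow> unique_minimizer permanent (Mat_set n c) (uniform_mat n c)"
proof (cases "n = 1")
  case True
  have "unique_minimizer permanent (Mat_set n c) (uniform_mat n c)"
    if c: "c \<in> pos_vecs n" and sum: "(\<Sum>i = 0..<n. c $ i) = real n" for c
  proof -
    have cc: "c \<in> carrier_vec n" using c by (simp add: pos_vecs_def)
    have U: "uniform_mat n c \<in> Mat_set n c" using uniform_mat_in_Mat_set[OF c sum n] .
    have "M = uniform_mat n c" if "M \<in> Mat_set n c" for M
      using Mat_setD(2,3,5)[OF that] Mat_setD(2,3,5)[OF U] True by (intro eq_matI) auto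
    with U have "Mat_set n c = {uniform_mat n c}" by blast
    then show ?thesis using unique_minimizer_singleton by metis
  qed
  then show thesis using that[of 1] by simp
next
  case False
  then have n2: "2 \<le> n" using n by simp
  define K where "K = gurvits (n - 1) / gurvits n"
  have K: "1 < K" unfolding K_def
    using gurvits_strict_decreasing[OF n2] gurvits_pos[OF n] by simp
  \<comment> \<open>Chosen so that Bernoulli's inequality gives
    \<open>L \<ge> 1 - n * \<delta> = (1 + 1 / K) / 2 > 1 / K\<close>.\<close>
  define \<delta> where "\<delta> = (1 - 1 / K) / (2 * real n)"
  have iK: "0 < 1 / K" "1 / K < 1" using K by simp_all
  have "0 < e / (2 * real n) \<and> e / (2 * real n) < 1" if "0 < e" "e < 1" for e
    using that n by (simp add: divide_less_eq)
  from this[of "1 - 1 / K"] have \<delta>: "0 < \<delta>" "\<delta> < 1" using K by (simp_all add: \<delta>_def)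
  define L where "L = (1 - \<delta>) ^ n"
  have L: "0 < L" using \<delta> by (simp add: L_def)
  have "real n * \<delta> = (1 - 1 / K) / 2" using n by (simp add: \<delta>_def)
  moreover have "e < 1 - (1 - e) / 2" if "e < 1" for e :: real
    using that by (simp add: field_simps)
  ultimately have "1 / K < 1 - real n * \<delta>" using iK(2) by presburger
  also have "\<dots> \<le> L"
    using Bernoulli_inequality[of "- \<delta>" n] \<delta> by (simp add: L_def)
  finally have KL: "1 / L < K" using L K by (simp add: field_simps)
  obtain \<epsilon> where \<epsilon>: "0 < \<epsilon>" and cap: "\<And>c M x. c \<in> carrier_vec n \<Longrightarrow> l1_norm (c - ones_vec n) < \<epsilon> \<Longrightarrow> M \<in> Mat_set n c
      \<Longrightarrow> x \<in> pos_vecs n \<Longrightarrow> L * (\<Prod>i = 0..<n. x $ i) \<le> prod_poly M x"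
    using capacity_lower_bound_near_ones[OF \<delta>, of n] unfolding L_def by blast
  show thesis
  proof (rule that[OF \<epsilon>])
    fix c assume c: "c \<in> pos_vecs n" and sum: "(\<Sum>i = 0..<n. c $ i) = real n" and near: "l1_norm (c - ones_vec n) < \<epsilon>"
    have cc: "c \<in> carrier_vec n" "\<And>i. i < n \<Longrightarrow> 0 \<le> c $ i" using c by (auto simp: pos_vecs_def intro: less_imp_le)
    have "(\<Prod>i = 0..<n. c $ i) \<le> 1"
      using prod_le_mean_power[of "{0..<n}" "\<lambda>i. c $ i"] cc sum n by simp
    then have "(\<Prod>i = 0..<n. c $ i) / L < K"
      using KL L by (intro le_less_trans[OF divide_right_mono KL]) auto
    then show "unique_minimizer permanent (Mat_set n c) (uniform_mat n c)"
      using unique_minimizer_from_capacity[OF n2 c sum L cap[OF cc(1) near]] unfolding K_def by blast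
  qed
qed

text \<open>The real infimum is a genuine lower bound here because non-negative entries keep the
  quotients above 0.\<close>

lemma Cap_one_prod_poly_le:
  assumes M: "M \<in> Mat_set n c" and x: "x \<in> pos_vecs n"
  shows "Cap_one n (prod_poly M) * (\<Prod>i = 0..<n. x $ i) \<le> prod_poly M x"
proof -
  have y: "0 < y $ j" if "y \<in> pos_vecs n" "j < n" for y j using that by (simp add: pos_vecs_def)
  have pos: "0 < (\<Prod>i = 0..<n. y $ i)" if "y \<in> pos_vecs n" for y
    using y[OF that] by (intro prod_pos) auto
  have nn: "0 \<le> prod_poly M y" if "y \<in> pos_vecs n" for y
    unfolding prod_poly_def Mat_setD(2,3)[OF M] using y[OF that] Mat_setD(4)[OF M]
    by (intro prod_nonneg sum_nonneg mult_nonneg_nonneg ballI) (auto intro: less_imp_le)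
  have "Cap_one n (prod_poly M) \<le> prod_poly M x / (\<Prod>i = 0..<n. x $ i)"
    unfolding Cap_one_def using pos nn x
    by (intro cINF_lower bdd_belowI2[of _ 0]) (auto intro: divide_nonneg_pos)
  then show ?thesis using pos[OF x] by (simp add: pos_le_divide_eq)
qed

theorem theorem2p3:
  shows "(\<forall>n::nat. 1 \<le> n \<longrightarrow>
           (\<exists>\<epsilon>::real. 0 < \<epsilon> \<and>
             (\<forall>c \<in> pos_vecs n.
                (\<Sum>i = 0..<n. c $ i) = real n \<longrightarrow>
                l1_norm (c - ones_vec n) < \<epsilon> \<longrightarrow>
                unique_minimizer permanent (Mat_set n c)
                  ((1 / real n) \<cdot>\<^sub>m outer_prod (ones_vec n) c))))
       \<and>
         (\<forall>n::nat. 2 \<le> n \<longrightarrow>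
           (\<forall>c \<in> pos_vecs n. \<forall>L::real.
              (\<Sum>i = 0..<n. c $ i) = real n \<longrightarrow>
              0 < L \<longrightarrow>
              (\<forall>M \<in> Mat_set n c. L \<le> Cap_one n (prod_poly M)) \<longrightarrow>
              (\<Prod>i = 0..<n. c $ i) / L
                < (real (n - 2) ^ (n - 2) * real n ^ (n - 1)) / real (n - 1) ^ (2 * n - 3) \<longrightarrow>
              unique_minimizer permanent (Mat_set n c)
                ((1 / real n) \<cdot>\<^sub>m outer_prod (ones_vec n) c)))"
proof (intro conjI allI impI ballI)
  fix n :: nat assume n: "1 \<le> n"
  show "\<exists>\<epsilon>::real. 0 < \<epsilon> \<and> (\<forall>c \<in> pos_vecs n. (\<Sum>i = 0..<n. c $ i) = real n \<longrightarrow>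
      l1_norm (c - ones_vec n) < \<epsilon> \<longrightarrow> unique_minimizer permanent (Mat_set n c) (uniform_mat n c))"
    using unique_minimizer_near_ones[OF n] by metis
next
  fix n :: nat and c and L :: real
  assume n: "2 \<le> n" and c: "c \<in> pos_vecs n" and sum: "(\<Sum>i = 0..<n. c $ i) = real n" and L: "0 < L"
    and cap: "\<forall>M \<in> Mat_set n c. L \<le> Cap_one n (prod_poly M)"
    and less: "(\<Prod>i = 0..<n. c $ i) / L
      < (real (n - 2) ^ (n - 2) * real n ^ (n - 1)) / real (n - 1) ^ (2 * n - 3)"
  show "unique_minimizer permanent (Mat_set n c) (uniform_mat n c)"
  proof (rule unique_minimizer_from_capacity[OF n c sum L])
    fix M x assume M: "M \<in> Mat_set n c" and x: "x \<in> pos_vecs n"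
    have "L * (\<Prod>i = 0..<n. x $ i) \<le> Cap_one n (prod_poly M) * (\<Prod>i = 0..<n. x $ i)"
      using cap M x by (intro mult_right_mono prod_nonneg) (auto simp: pos_vecs_def less_imp_le)
    also have "\<dots> \<le> prod_poly M x" by (rule Cap_one_prod_poly_le[OF M x])
    finally show "L * (\<Prod>i = 0..<n. x $ i) \<le> prod_poly M x" .
  qed (use less gurvits_ratio[OF n] in simp)
qed

end
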